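(* Let $(\zeta_t)_{t\in\mathbb Z}$ and $(\sigma_t)_{t\in\mathbb Z}$ be the stationary GARCH$(1,1)$ processes described in the context, and let $\alpha$ be as defined there. Then for all $m,n\in\mathbb N_0$, as $x\to\infty$, weakly, $$\mathcal L\left(\frac{\sigma_{-m}}{x},\dots,\frac{\sigma_n}{x}\;\middle|\;|\zeta_0|>x\right)\to\mathcal L\left(\sigma_{-m}^{(\zeta)},\dots,\sigma_n^{(\zeta)}\right),$$ where $(\sigma_0^{(\zeta)},\sigma_1^{(\zeta)})$ is the random vector defined in the context and $$\sigma_t^{(\zeta)}=\sigma_{t-1}^{(\zeta)}A_t,\quad t\ge 2,\qquad \sigma_{-t}^{(\zeta)}=\sigma_{-t+1}^{(\zeta)}A_{-t},\quad t\ge 1.$$ Here $A_t=\sqrt{\alpha_1\hat\epsilon_t^2+\beta_1}$ for $t\ge 2$, with $(\hat\epsilon_t)_{t\ge 2}$ an i.i.d. standard normal sequence independent of $(\sigma_0^{(\zeta)},\sigma_1^{(\zeta)})$, and $A_{-t}$, $t\in\mathbb N$, are i.i.d. random variables on $(0,\beta_1^{-1/2})$ (i.e. on $(0,\infty)$ if $\beta_1=0$), independent of $(A_t)_{t\ge 2}$ and $(\sigma_0^{(\zeta)},\sigma_1^{(\zeta)})$, with distribution function $$P(A_{-1}\le x)=\sqrt{2/\pi}\int_{\left(\frac{x^{-2}-\beta_1}{\alpha_1}\right)^{1/2}}^{\infty}(\alpha_1z^2+\beta_1)^{\alpha}\exp\left(-\tfrac12z^2\right)dz,\qquad 0<x<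\beta_1^{-1/2}.$$
   Context: GARCH$(1,1)$ setting: $\alpha_0>0$, $\alpha_1>0$, $\beta_1\ge 0$, $\alpha_1+\beta_1<1$; $(\epsilon_t)_{t\in\mathbb Z}$ are i.i.d. standard normal; $(\zeta_t,\sigma_t)_{t\in\mathbb Z}$ is the strictly stationary solution of $$\zeta_t=\sigma_t\epsilon_{t+1},\qquad \sigma_t=\sqrt{\alpha_0+\alpha_1\sigma_{t-1}^2\epsilon_t^2+\beta_1\sigma_{t-1}^2},\qquad t\in\mathbb Z,$$ where $(\epsilon_t)_{t>r}$ is independent of $(\sigma_t)_{t\le r}$ for each $r\in\mathbb Z$. $\alpha$ denotes the unique positive solution of $E\left([\alpha_1\epsilon_0^2+\beta_1]^\alpha\right)=1$. Known fact: $\sigma_0^2$ is regularly varying with index $\alpha$, i.e. $\lim_{x\to\infty}P(\sigma_0>ux)/P(\sigma_0>x)=u^{-2\alpha}$ for all $u>0$. The vector $(\sigma_0^{(\zeta)},\sigma_1^{(\zeta)})$: let $|\zeta_0|^{(\zeta)}$ and $\epsilon_1^{(\zeta)}$ be independent, where $P(|\zeta_0|^{(\zeta)}>x)=x^{-2\alpha}$ for $x\ge1$ and $\epsilon_1^{(\zeta)}$ is symmetric with $(\epsilon_1^{(\zeta)})^2/2$ Gamma distributed with shape $\alpha+1/2$ and scale $1$. Then $\sigma_0^{(\zeta)}=|\zeta_0|^{(\zeta)}/|\epsilon_1^{(\zeta)}|$ and $\sigma_1^{(\zeta)}=\sigma_0^{(\zeta)}\sqrt{\alpha_1(\epsilon_1^{(\zeta)})^2+\beta_1}$.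 Convention: $\beta_1^{-1/2}=\infty$ if $\beta_1=0$. *)

theory Defs
  imports "HOL-Probability.Probability"
begin

definition strictly_stationary :: "'a measure \<Rightarrow> 'b measure \<Rightarrow> (int \<Rightarrow> 'a \<Rightarrow> 'b) \<Rightarrow> bool" where
  "strictly_stationary M K X \<longleftrightarrow>
     (\<forall>h. distr M (\<Pi>\<^sub>M t\<in>UNIV. K) (\<lambda>\<omega> t. X (t + h) \<omega>) = distr M (\<Pi>\<^sub>M t\<in>UNIV. K) (\<lambda>\<omega> t. X t \<omega>))"

text \<open>
  The conditional law of \<open>X\<close> given the event \<open>E\<close>; \<^const>\<open>uniform_measure\<close> \<open>M E\<close> is the measure
  \<open>F \<mapsto> M (E \<inter> F) / M E\<close>.
\<close>

definition cond_law :: "'a measure \<Rightarrow> 'b measure \<Rightarrow> ('a \<Rightarrow> 'b) \<Rightarrow> 'a set \<Rightarrow> 'b measure" where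
  "cond_law M K X E = distr (uniform_measure M E) K X"

text \<open>
  \<^const>\<open>weak_conv_m\<close> only covers measures on the real line. The following is meant for Borel
  probability measures of the topology \<open>T\<close>. For finite \<open>I\<close> and
  \<open>T = product_topology (\<lambda>_. euclideanreal) I\<close> these are the laws on \<open>\<Pi>\<^sub>M i\<in>I. borel\<close>.
\<close>

definition weak_conv_on ::
  "'a topology \<Rightarrow> ('b \<Rightarrow> 'a measure) \<Rightarrow> 'a measure \<Rightarrow> 'b filter \<Rightarrow> bool" where
  "weak_conv_on T \<mu> \<nu> F \<longleftrightarrow>
     (\<forall>f. continuous_map T euclideanreal f \<and> bounded (f ` topspace T) \<longrightarrow>
        ((\<lambda>x. \<integral>y. f y \<partial>(\<mu> x)) \<longlongrightarrow> (\<integral>y. f y \<partial>\<nu>)) F)"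

definition gamma_density :: "real \<Rightarrow> real \<Rightarrow> real" where
  "gamma_density a x = (if x > 0 then x powr (a - 1) * exp (- x) / Gamma a else 0)"

text \<open>
  The stationary GARCH(1,1) model; \<open>\<alpha>\<close> is the tail index of \<open>\<sigma>\<^sub>0\<^sup>2\<close>. It is
  characterised as a positive solution of the moment equation; by strict convexity of
  \<open>a \<mapsto> E [(\<alpha>1 \<epsilon>\<^sub>0\<^sup>2 + \<beta>1)\<^sup>a]\<close>, with value 1 at \<open>a = 0\<close>, there is at most one.
\<close>

locale garch11 = prob_space M for M :: "'a measure" +
  fixes \<alpha>0 \<alpha>1 \<beta>1 \<alpha> :: real
    and \<epsilon> \<zeta> \<sigma> :: "int \<Rightarrow> 'a \<Rightarrow> real"
  assumes \<alpha>0_pos: "\<alpha>0 > 0"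
    and \<alpha>1_pos: "\<alpha>1 > 0"
    and \<beta>1_nonneg: "\<beta>1 \<ge> 0"
    and sum_less_1: "\<alpha>1 + \<beta>1 < 1"
    and \<epsilon>_indep: "indep_vars (\<lambda>_. borel) \<epsilon> UNIV"
    and \<epsilon>_normal: "\<And>t. distributed M lborel (\<epsilon> t) std_normal_density"
    and \<zeta>_measurable: "\<And>t. random_variable borel (\<zeta> t)"
    and \<sigma>_measurable: "\<And>t. random_variable borel (\<sigma> t)"
    and \<zeta>_eq: "\<And>t. AE \<omega> in M. \<zeta> t \<omega> = \<sigma> t \<omega> * \<epsilon> (t + 1) \<omega>"
    and \<sigma>_eq: "\<And>t. AE \<omega> in M.
          \<sigma> t \<omega> = sqrt (\<alpha>0 + \<alpha>1 * (\<sigma> (t - 1) \<omega>)\<^sup>2 * (\<epsilon> t \<omega>)\<^sup>2 + \<beta>1 * (\<sigma> (t - 1) \<omega>)\<^sup>2)"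
    and stationary: "strictly_stationary M borel (\<lambda>t \<omega>. (\<zeta> t \<omega>, \<sigma> t \<omega>))"
    and future_indep: "\<And>r. indep_var
          (\<Pi>\<^sub>M t\<in>{r<..}. borel) (\<lambda>\<omega>. \<lambda>t\<in>{r<..}. \<epsilon> t \<omega>)
          (\<Pi>\<^sub>M t\<in>{..r}. borel) (\<lambda>\<omega>. \<lambda>t\<in>{..r}. \<sigma> t \<omega>)"
    and \<alpha>_pos: "\<alpha> > 0"
    and \<alpha>_eq: "expectation (\<lambda>\<omega>. (\<alpha>1 * (\<epsilon> 0 \<omega>)\<^sup>2 + \<beta>1) powr \<alpha>) = 1"

text \<open>
  The limit process \<open>S t = \<sigma>\<^sub>t\<^sup>(\<^sup>\<zeta>\<^sup>)\<close>, realised on an arbitrary probability space, with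
  \<open>Z = |\<zeta>\<^sub>0|\<^sup>(\<^sup>\<zeta>\<^sup>)\<close> and \<open>e = \<epsilon>\<^sub>1\<^sup>(\<^sup>\<zeta>\<^sup>)\<close>.
  The factors \<open>A t\<close> are used only for \<open>t \<ge> 2\<close> and \<open>t \<le> -1\<close>, and \<open>h t\<close> only for \<open>t \<ge> 2\<close>.
  In \<open>A_backward_indep_rest\<close> the second vector is \<open>(S 0, S 1, A 2, A 3, \<dots>)\<close>: the backward
  factors are jointly independent of \<open>(A t)\<close>, \<open>t \<ge> 2\<close>, and \<open>(S 0, S 1)\<close>. (\<open>indep_var\<close> requires
  both variables to have the same type, which rules out mixing sequences and tuples.)
\<close>

definition backward_range :: "real \<Rightarrow> real set" where
  \<comment> \<open>the interval \<open>(0, \<beta>1\<^sup>-\<^sup>1\<^sup>/\<^sup>2)\<close>, with right end point infinity if \<open>\<beta>1 = 0\<close>\<close>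
  "backward_range \<beta>1 = (if \<beta>1 = 0 then {0<..} else {0<..<\<beta>1 powr (-1/2)})"

locale garch11_tail_process = prob_space N for N :: "'b measure" +
  fixes \<alpha>1 \<beta>1 \<alpha> :: real
    and Z e :: "'b \<Rightarrow> real"
    and h A S :: "int \<Rightarrow> 'b \<Rightarrow> real"
  assumes Z_e_indep: "indep_var borel Z borel e"
    and Z_tail: "\<And>x. x \<ge> 1 \<Longrightarrow> prob {\<omega> \<in> space N. Z \<omega> > x} = x powr (- 2 * \<alpha>)"
    and e_symmetric: "distr N borel (\<lambda>\<omega>. - e \<omega>) = distr N borel e"
    and e_gamma: "distributed N lborel (\<lambda>\<omega>. (e \<omega>)\<^sup>2 / 2) (gamma_density (\<alpha> + 1/2))"
    and S_0: "\<And>\<omega>. \<omega> \<in> space N \<Longrightarrow> S 0 \<omega> = Z \<omega> / \<bar>e \<omega>\<bar>"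
    and S_1: "\<And>\<omega>. \<omega> \<in> space N \<Longrightarrow> S 1 \<omega> = S 0 \<omega> * sqrt (\<alpha>1 * (e \<omega>)\<^sup>2 + \<beta>1)"
    and S_forward: "\<And>t \<omega>. t \<ge> 2 \<Longrightarrow> \<omega> \<in> space N \<Longrightarrow> S t \<omega> = S (t - 1) \<omega> * A t \<omega>"
    and S_backward: "\<And>t \<omega>. t \<ge> 1 \<Longrightarrow> \<omega> \<in> space N \<Longrightarrow> S (- t) \<omega> = S (- t + 1) \<omega> * A (- t) \<omega>"
    and h_indep: "indep_vars (\<lambda>_. borel) h {2..}"
    and h_normal: "\<And>t. t \<ge> 2 \<Longrightarrow> distributed N lborel (h t) std_normal_density"
    and h_indep_start: "indep_var
          (\<Pi>\<^sub>M t\<in>{2..}. borel) (\<lambda>\<omega>. \<lambda>t\<in>{2..}. h t \<omega>)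
          (\<Pi>\<^sub>M t\<in>{0, 1}. borel) (\<lambda>\<omega>. \<lambda>t\<in>{0, 1}. S t \<omega>)"
    and A_forward: "\<And>t \<omega>. t \<ge> 2 \<Longrightarrow> \<omega> \<in> space N \<Longrightarrow> A t \<omega> = sqrt (\<alpha>1 * (h t \<omega>)\<^sup>2 + \<beta>1)"
    and A_backward_indep: "indep_vars (\<lambda>_. borel) A {..-1}"
    and A_backward_range: "\<And>t. t \<le> -1 \<Longrightarrow> AE \<omega> in N. A t \<omega> \<in> backward_range \<beta>1"
    and A_backward_cdf: "\<And>t x. t \<le> -1 \<Longrightarrow> x \<in> backward_range \<beta>1 \<Longrightarrow>
          prob {\<omega> \<in> space N. A t \<omega> \<le> x} =
            sqrt (2 / pi) * (LBINT z:{sqrt ((1 / x\<^sup>2 - \<beta>1) / \<alpha>1)..}.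
                              (\<alpha>1 * z\<^sup>2 + \<beta>1) powr \<alpha> * exp (- (1/2) * z\<^sup>2))"
    and A_backward_indep_rest: "indep_var
          (\<Pi>\<^sub>M t\<in>{..-1}. borel) (\<lambda>\<omega>. \<lambda>t\<in>{..-1}. A t \<omega>)
          (\<Pi>\<^sub>M t\<in>{0..}. borel) (\<lambda>\<omega>. \<lambda>t\<in>{0..}. if t \<le> 1 then S t \<omega> else A t \<omega>)"

end

(*
The tail of sigma_0 is regularly varying, so the law of s/y given s > y, where s has the law of
sigma_{-m}, converges to a Pareto law. Expanding the recursion, sigma_{-m+k}^2 = s^2 p_k + alpha0 q_k
with p_k, q_k functions of the innovations after time -m, which are independent of s. For fixed
innovations, |zeta_0| > x says that s exceeds a threshold asymptotic to x / d, where
d = sqrt(p_m) |epsilon_1|. Hence E[f(sigma/x); |zeta_0| > x] / P(sigma_0 > x) tends to the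
expectation of d^(2 alpha) f(Z sqrt(p_k) / d) with Z Pareto distributed and independent of the
innovations; a Potter bound gives dominated convergence.
The weight d^(2 alpha) is |epsilon_1|^(2 alpha) times a product of the factors
(alpha1 epsilon_t^2 + beta1)^alpha, each of mean one, so that under the weighted measure the
innovations stay independent, epsilon_1^2/2 becomes Gamma distributed, and the reciprocal factors
1 / sqrt(alpha1 epsilon_t^2 + beta1), t <= 0, acquire the law of the backward factors.
*)

theory Submission
  imports Defs
begin

text \<open>The conditioning event is a discontinuous functional of the path. For fixed innovations
  it is a half-line s > Y, so it is absorbed exactly into the excess law of s, and only continuous
  functionals meet a weak limit. They still move with x, through Y and the terms alpha0 q_k / x^2;
  pointwise convergent copies of the excesses (Skorohod) cope with that. Starting at the earliest
  time of the window leaves a single heavy-tailed variable, while the coefficients p_k and q_k are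
  polynomials in normal innovations, with all moments; this makes domination possible. The starting
  time disappears in the limit: in sqrt(p_k) / d the common factors cancel, so that, apart from 1 /
  |epsilon_1|, a coordinate at t < 0 keeps only reciprocals of the factors at times t+1, ..., 0 and
  a coordinate at t > 0 only the factors at times 1, ..., t. The weight has total mass
  E|epsilon_1|^(2 alpha), which is also the limit of P(|zeta_0| > x) / P(sigma_0 > x), the case f =
  1. One limit theorem thus serves numerator and denominator of the conditional expectation.\<close>

lemma (in prob_space) integral_uniform_measure:
  fixes g :: "'a \<Rightarrow> real"
  assumes E [measurable]: "E \<in> events" and nz: "prob E \<noteq> 0" and [measurable]: "g \<in> borel_measurable M"
  shows "(\<integral>\<omega>. g \<omega> \<partial>uniform_measure M E) = (\<integral>\<omega>. g \<omega> * indicator E \<omega> \<partial>M) / prob E"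
proof -
  have "uniform_measure M E = density M (\<lambda>\<omega>. ennreal (indicator E \<omega> / prob E))"
    unfolding uniform_measure_def
  proof (rule density_cong)
    show "AE \<omega> in M. indicator E \<omega> / emeasure M E = ennreal (indicator E \<omega> / prob E)"
      using nz by (auto simp: emeasure_eq_measure divide_ennreal[symmetric] zero_less_measure_iff split: split_indicator)
  qed auto
  then have "(\<integral>\<omega>. g \<omega> \<partial>uniform_measure M E) = (\<integral>\<omega>. (indicator E \<omega> / prob E) * g \<omega> \<partial>M)"
    by (simp add: integral_density)
  then show ?thesis by (simp add: mult.commute)
qed

section \<open>Regularly varying tails and their excess laws\<close>

locale regularly_varying_tail = real_distribution \<mu> for \<mu> :: "real measure" +
  fixes \<kappa> :: real
  assumes tail_ratio_lim: "\<And>u. u > 0 \<Longrightarrow>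
    ((\<lambda>x. measure \<mu> {u * x<..} / measure \<mu> {x<..}) \<longlongrightarrow> u powr (- \<kappa>)) at_top"
begin

abbreviation tail :: "real \<Rightarrow> real" where
  "tail x \<equiv> measure \<mu> {x<..}"

lemma tail_antimono: "x \<le> y \<Longrightarrow> tail y \<le> tail x"
  by (rule finite_measure_mono) auto

text \<open>A tail that vanishes once vanishes from there on, so the ratio at u = 1 would be 0 / 0 =
  0 eventually, whereas its limit is 1.\<close>

lemma tail_pos: "tail x > 0"
proof (rule ccontr)
  assume "\<not> tail x > 0"
  then have "tail y = 0" if "y \<ge> x" for y
    using tail_antimono[OF that] measure_nonneg[of \<mu> "{y<..}"] by linarith
  then have "eventually (\<lambda>y. tail (1 * y) / tail y = 0) at_top"
    using eventually_mono[OF eventually_ge_at_top[of x], of "\<lambda>y. tail (1 * y) / tail y = 0"] by simp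
  from Lim_transform_eventually[OF tail_ratio_lim[of 1] this]
  have "((\<lambda>_. 0::real) \<longlongrightarrow> 1) (at_top :: real filter)" by simp
  then show False by (simp add: tendsto_const_iff)
qed

text \<open>Regular variation speaks only of exact multiples of X n. Since the tail is monotone,
  \<open>tail (Y n)\<close> is squeezed between its values at (b - t) X n and (b + t) X n, and the
  two limits are close because \<open>powr\<close> is continuous at b.\<close>

lemma tail_scaled_tendsto:
  assumes X: "filterlim X at_top sequentially" and b: "b > 0"
    and Y: "(\<lambda>n. Y n / X n) \<longlonglongrightarrow> b"
  shows "(\<lambda>n. tail (Y n) / tail (X n)) \<longlonglongrightarrow> b powr (- \<kappa>)"
proof (rule LIMSEQ_I)
  fix r :: real assume r: "r > 0"
  have *: "(\<lambda>n. tail (u * X n) / tail (X n)) \<longlonglongrightarrow> u powr (- \<kappa>)" if "u > 0" for u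
    using filterlim_compose[OF tail_ratio_lim[OF that] X] .
  have "((\<lambda>u. u powr (- \<kappa>)) \<longlongrightarrow> b powr (- \<kappa>)) (nhds b)"
    using b by (intro tendsto_powr filterlim_ident tendsto_const) auto
  then have "eventually (\<lambda>u. \<bar>u powr (- \<kappa>) - b powr (- \<kappa>)\<bar> < r / 2) (nhds b)"
    using r by (auto dest!: tendstoD[where e="r/2"] simp: dist_real_def)
  then obtain d where d: "d > 0" "\<And>u. \<bar>u - b\<bar> < d \<Longrightarrow> \<bar>u powr (- \<kappa>) - b powr (- \<kappa>)\<bar> < r / 2"
    by (auto simp: eventually_nhds_metric dist_real_def)
  \<comment> \<open>Halving keeps t strictly below d, so both b - t and b + t are in the range of
    continuity, and strictly below b, so regular variation applies to the positive multiple b -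
    t.\<close>
  define t where "t = min d b / 2"
  have t: "t > 0" "t < d" "t < b" using d b by (auto simp: t_def)
  have lo: "(\<lambda>n. tail ((b - t) * X n) / tail (X n)) \<longlonglongrightarrow> (b - t) powr (- \<kappa>)"
    and hi: "(\<lambda>n. tail ((b + t) * X n) / tail (X n)) \<longlonglongrightarrow> (b + t) powr (- \<kappa>)"
    using t b by (auto intro!: *)
  have lo': "\<bar>(b - t) powr (- \<kappa>) - b powr (- \<kappa>)\<bar> < r / 2"
    and hi': "\<bar>(b + t) powr (- \<kappa>) - b powr (- \<kappa>)\<bar> < r / 2"
    using t d(2)[of "b - t"] d(2)[of "b + t"] by auto
  have "eventually (\<lambda>n. tail ((b - t) * X n) / tail (X n) < b powr (- \<kappa>) + r) sequentially"
    using lo' r by (intro order_tendstoD[OF lo]) linarith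
  moreover have "eventually (\<lambda>n. tail ((b + t) * X n) / tail (X n) > b powr (- \<kappa>) - r) sequentially"
    using hi' r by (intro order_tendstoD[OF hi]) linarith
  moreover have "eventually (\<lambda>n. X n > 0) sequentially"
    using X by (simp add: filterlim_at_top_dense)
  moreover have "eventually (\<lambda>n. \<bar>Y n / X n - b\<bar> < t) sequentially"
    using tendstoD[OF Y t(1)] by (simp add: dist_real_def)
  ultimately have "eventually (\<lambda>n. \<bar>tail (Y n) / tail (X n) - b powr (- \<kappa>)\<bar> < r) sequentially"
  proof eventually_elim
    case (elim n)
    have "Y n \<ge> (b - t) * X n" "Y n \<le> (b + t) * X n"
      using elim by (auto simp: abs_less_iff field_simps)
    then have "tail (Y n) / tail (X n) \<le> tail ((b - t) * X n) / tail (X n)"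
      "tail (Y n) / tail (X n) \<ge> tail ((b + t) * X n) / tail (X n)"
      by (auto intro!: divide_right_mono tail_antimono)
    with elim show ?case by linarith
  qed
  then show "\<exists>no. \<forall>n\<ge>no. norm (tail (Y n) / tail (X n) - b powr - \<kappa>) < r"
    by (simp add: eventually_sequentially)
qed

text \<open>A crude Potter bound, obtained by halving.\<close>

lemma tail_potter:
  obtains C x0 :: real and K :: nat where "C \<ge> 1" "x0 > 0"
    "\<And>x u. x \<ge> x0 \<Longrightarrow> u \<ge> 1 \<Longrightarrow> tail (x / u) \<le> C * u ^ K * tail x"
proof -
  \<comment> \<open>The limit of tail (x / 2) / tail x is \<open>2 powr \<kappa>\<close>; a strictly
    larger bound holds eventually. A natural exponent turns the later domination into a question
    about polynomial moments.\<close>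
  obtain K :: nat where K: "2 powr \<kappa> < 2 ^ K"
    using real_arch_pow[of 2 "2 powr \<kappa>"] by auto
  have "eventually (\<lambda>x. tail (1/2 * x) / tail x < 2 ^ K) at_top"
    using tail_ratio_lim[of "1/2"] K
    by (intro order_tendstoD) (auto simp: powr_divide powr_minus divide_simps)
  then obtain x1 where x1: "\<And>x. x \<ge> x1 \<Longrightarrow> tail (1/2 * x) / tail x < 2 ^ K"
    by (auto simp: eventually_at_top_linorder)
  define x0 where "x0 = max x1 1"
  have x0: "x0 > 0" "\<And>x. x \<ge> x0 \<Longrightarrow> tail (x / 2) \<le> 2 ^ K * tail x"
    using x1 tail_pos by (auto simp: x0_def divide_simps less_imp_le)
  \<comment> \<open>Halving must stop before x leaves the range x >= x0. Below 2 * x0 this C makes C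
    * tail x >= 1, which bounds any probability.\<close>
  define C where "C = 1 / tail (2 * x0)"
  have C: "C \<ge> 1"
    using tail_pos prob_le_1 by (auto simp: C_def divide_simps)
  have main: "tail (x / u) \<le> C * 2 ^ (K * j) * tail x" if "x \<ge> x0" "u \<ge> 1" "u \<le> 2 ^ j" for j x u
    using that
  proof (induction j arbitrary: x u)
    case 0
    then have "u = 1" by simp
    then show ?case using C tail_pos[of x] by simp
  next
    case (Suc j)
    consider "x < 2 * x0" | "x \<ge> 2 * x0" "u < 2" | "x \<ge> 2 * x0" "u \<ge> 2" by linarith
    then show ?case
    proof cases
      case 1
      then have "tail (2 * x0) \<le> tail x" by (intro tail_antimono) auto
      then have "1 \<le> C * tail x" using tail_pos by (simp add: C_def divide_simps)
      also have "\<dots> \<le> C * tail x * 2 ^ (K * Suc j)"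
        using C tail_pos[of x] mult_left_mono[of 1 "2 ^ (K * Suc j)" "C * tail x"]
          one_le_power[of "2::real" "K * Suc j"] by (simp del: power_Suc mult_Suc_right)
      finally show ?thesis using prob_le_1[of "{x / u<..}"]
        by (simp only: mult_ac)
    next
      case 2
      have "tail (x / u) \<le> tail (x / 2)"
        using 2 Suc.prems x0(1) by (intro tail_antimono divide_left_mono) auto
      also have "\<dots> \<le> 2 ^ K * tail x" using Suc.prems by (intro x0)
      also have "\<dots> \<le> C * 2 ^ (K * Suc j) * tail x"
      proof (rule mult_right_mono)
        have "(2::real) ^ K \<le> 2 ^ (K * Suc j)" by (intro power_increasing) auto
        also have "\<dots> \<le> C * 2 ^ (K * Suc j)" using C by simp
        finally show "(2::real) ^ K \<le> C * 2 ^ (K * Suc j)" .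
      qed simp
      finally show ?thesis .
    next
      case 3
      have "tail (x / u) = tail ((x / 2) / (u / 2))" by simp
      also have "\<dots> \<le> C * 2 ^ (K * j) * tail (x / 2)"
        using 3 Suc.prems by (intro Suc.IH) auto
      also have "\<dots> \<le> C * 2 ^ (K * j) * (2 ^ K * tail x)"
        using C Suc.prems by (intro mult_left_mono x0) auto
      finally show ?thesis by (simp add: power_add mult_ac)
    qed
  qed
  have "tail (x / u) \<le> (C * 2 ^ K) * u ^ K * tail x" if "x \<ge> x0" "u \<ge> 1" for x u
  proof -
    \<comment> \<open>Rounding up gives u <= 2 ^ j <= 2 * u; the surplus factor 2, raised to the
      power K, goes into the constant.\<close>
    define j where "j = nat \<lceil>log 2 u\<rceil>"
    have l: "log 2 u \<ge> 0" using that by simp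
    have "u = 2 powr log 2 u" using that by simp
    also have "\<dots> \<le> 2 powr real j" unfolding j_def by (intro powr_mono) linarith+
    finally have j1: "u \<le> 2 ^ j" by (simp add: powr_realpow)
    have "real j \<le> log 2 u + 1" using l unfolding j_def by linarith
    then have "2 powr real j \<le> 2 powr (log 2 u + 1)" by (intro powr_mono) auto
    also have "\<dots> = 2 * u" using that by (simp add: powr_add)
    finally have j2: "2 ^ j \<le> 2 * u" by (simp add: powr_realpow)
    have "tail (x / u) \<le> C * 2 ^ (K * j) * tail x" using that j1 by (intro main)
    also have "(2::real) ^ (K * j) = (2 ^ j) ^ K" by (metis power_mult mult.commute)
    also have "C * (2 ^ j) ^ K * tail x \<le> C * (2 * u) ^ K * tail x"
      using j2 C by (intro mult_right_mono mult_left_mono power_mono) auto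
    finally show ?thesis by (simp add: power_mult_distrib mult_ac)
  qed
  moreover have "C * 2 ^ K \<ge> 1" using C mult_mono[of 1 C 1 "2 ^ K"] by simp
  ultimately show ?thesis using that x0(1) by blast
qed

end

lemma cdf_pareto:
  assumes "real_distribution \<pi>" and tail: "\<And>x. x \<ge> 1 \<Longrightarrow> measure \<pi> {x<..} = x powr (- \<kappa>)"
  shows "cdf \<pi> x = (if x \<ge> 1 then 1 - x powr (- \<kappa>) else 0)"
proof -
  interpret real_distribution \<pi> by fact
  have compl: "cdf \<pi> y = 1 - measure \<pi> {y<..}" for y
  proof -
    have "{..y} = space \<pi> - {y<..}" by (auto simp: space_eq_univ)
    then show ?thesis unfolding cdf_def using prob_compl[of "{y<..}"] by auto
  qed
  show ?thesis
  proof (cases "x \<ge> 1")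
    case False
    have "cdf \<pi> x \<le> cdf \<pi> 1" using False by (intro cdf_nondecreasing) auto
    also have "\<dots> = 0" using compl[of 1] tail[of 1] by simp
    finally show ?thesis using False cdf_nonneg[of x] by auto
  qed (use compl tail in auto)
qed

context regularly_varying_tail
begin

definition excess_law :: "real \<Rightarrow> real measure" where
  "excess_law y = distr (uniform_measure \<mu> {y<..}) borel (\<lambda>s. s / y)"

lemma emeasure_tail_nz: "emeasure \<mu> {y<..} \<noteq> 0"
  using tail_pos[of y] by (simp add: emeasure_eq_measure)

lemma real_distribution_excess_law: "real_distribution (excess_law y)"
proof -
  interpret U: prob_space "uniform_measure \<mu> {y<..}"
    by (rule prob_space_uniform_measure) (auto simp: emeasure_tail_nz)
  show ?thesis unfolding excess_law_def
    by (rule U.real_distribution_distr) simp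
qed

lemma cdf_excess_law:
  assumes "y > 0"
  shows "cdf (excess_law y) u = (if u \<ge> 1 then 1 - tail (u * y) / tail y else 0)"
proof -
  have "cdf (excess_law y) u = measure (uniform_measure \<mu> {y<..}) {..u * y}"
    unfolding excess_law_def cdf_def using assms
    by (subst measure_distr) (auto simp: space_eq_univ field_simps intro!: arg_cong2[where f=measure])
  also have "\<dots> = measure \<mu> ({y<..} \<inter> {..u * y}) / tail y"
    by (subst measure_uniform_measure) (auto simp: emeasure_tail_nz)
  also have "\<dots> = (if u \<ge> 1 then 1 - tail (u * y) / tail y else 0)"
  proof (cases "u \<ge> 1")
    case True
    have "{y<..} \<inter> {..u * y} = {y<..} - {u * y<..}" by auto
    moreover have "y \<le> u * y" using True assms by simp
    ultimately have "measure \<mu> ({y<..} \<inter> {..u * y}) = tail y - tail (u * y)"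
      by (simp add: finite_measure_Diff)
    then show ?thesis using True tail_pos[of y] by (simp add: field_simps)
  next
    case False
    then have "u * y \<le> y" using assms by simp
    then have "{y<..} \<inter> {..u * y} = {}" by auto
    then show ?thesis using False by simp
  qed
  finally show ?thesis .
qed

lemma excess_law_weak_conv:
  assumes Y: "filterlim Y at_top sequentially"
    and \<pi>: "real_distribution \<pi>" "\<And>x. x \<ge> 1 \<Longrightarrow> measure \<pi> {x<..} = x powr (- \<kappa>)"
  shows "weak_conv_m (\<lambda>n. excess_law (Y n)) \<pi>"
  unfolding weak_conv_m_def weak_conv_def
proof (intro allI impI)
  fix x
  have "eventually (\<lambda>n. Y n > 0) sequentially"
    using Y by (simp add: filterlim_at_top_dense)
  then have ev: "eventually (\<lambda>n. (if x \<ge> 1 then 1 - tail (x * Y n) / tail (Y n) else 0)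
      = cdf (excess_law (Y n)) x) sequentially"
    by eventually_elim (simp add: cdf_excess_law)
  have "(\<lambda>n. if x \<ge> 1 then 1 - tail (x * Y n) / tail (Y n) else 0)
      \<longlonglongrightarrow> (if x \<ge> 1 then 1 - x powr (- \<kappa>) else 0)"
  proof (cases "x \<ge> 1")
    case True
    then have "(\<lambda>n. tail (x * Y n) / tail (Y n)) \<longlonglongrightarrow> x powr (- \<kappa>)"
      using filterlim_compose[OF tail_ratio_lim Y] by simp
    then show ?thesis using True by (auto intro!: tendsto_intros)
  qed simp
  then show "(\<lambda>n. cdf (excess_law (Y n)) x) \<longlonglongrightarrow> cdf \<pi> x"
    using Lim_transform_eventually[OF _ ev] by (simp add: cdf_pareto[OF \<pi>])
qed

lemma integral_excess_law:
  fixes g :: "real \<Rightarrow> real"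
  assumes [measurable]: "g \<in> borel_measurable borel"
  shows "(\<integral>u. g u \<partial>excess_law y) = (\<integral>s. g (s / y) * indicator {y<..} s \<partial>\<mu>) / tail y"
proof -
  have "(\<integral>u. g u \<partial>excess_law y) = (\<integral>s. g (s / y) \<partial>uniform_measure \<mu> {y<..})"
    unfolding excess_law_def by (rule integral_distr) auto
  also have "\<dots> = (\<integral>s. g (s / y) * indicator {y<..} s \<partial>\<mu>) / tail y"
    by (rule integral_uniform_measure) (use tail_pos[of y] in auto)
  finally show ?thesis .
qed

text \<open>The functional changes with n, so weak convergence of the excess laws cannot be applied
  to it directly. On a Skorohod space the excesses converge pointwise, and the continuous
  convergence \<open>conv\<close> together with boundedness gives the limit relative to
  \<open>tail (Y n)\<close>. Passing from there to \<open>tail (X n)\<close> costs the factor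
  \<open>b powr (- \<kappa>)\<close>.\<close>

lemma excess_functional_tendsto:
  fixes g :: "nat \<Rightarrow> real \<Rightarrow> real"
  assumes X: "filterlim X at_top sequentially" and b: "b > 0"
    and Y: "(\<lambda>n. Y n / X n) \<longlonglongrightarrow> b"
    and \<pi>: "real_distribution \<pi>" "\<And>x. x \<ge> 1 \<Longrightarrow> measure \<pi> {x<..} = x powr (- \<kappa>)"
    and g_meas: "\<And>n. g n \<in> borel_measurable borel" and g0_meas: "g0 \<in> borel_measurable borel"
    and bound: "\<And>n u. \<bar>g n u\<bar> \<le> B"
    and conv: "\<And>v u. v \<longlonglongrightarrow> u \<Longrightarrow> (\<lambda>n. g n (v n)) \<longlonglongrightarrow> g0 u"
  shows "(\<lambda>n. (\<integral>s. g n (s / Y n) * indicator {Y n<..} s \<partial>\<mu>) / tail (X n))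
           \<longlonglongrightarrow> b powr (- \<kappa>) * (\<integral>u. g0 u \<partial>\<pi>)"
proof -
  have evX: "eventually (\<lambda>n. X n > 0) sequentially"
    using X by (simp add: filterlim_at_top_dense)
  have "filterlim (\<lambda>n. Y n / X n * X n) at_top sequentially"
    using filterlim_tendsto_pos_mult_at_top[OF Y b X] .
  then have Y': "filterlim Y at_top sequentially"
    by (rule filterlim_mono_eventually) (use evX in \<open>auto elim!: eventually_mono\<close>)
  have wc: "weak_conv_m (\<lambda>n. excess_law (Y n)) \<pi>"
    using Y' \<pi> by (rule excess_law_weak_conv)
  obtain \<Omega> :: "real measure" and V V0 where sk: "prob_space \<Omega> \<and> (\<forall>n. V n \<in> measurable \<Omega> borel) \<and>
      (\<forall>n. distr \<Omega> borel (V n) = excess_law (Y n)) \<and> V0 \<in> measurable \<Omega> lborel \<and>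
      distr \<Omega> borel V0 = \<pi> \<and> (\<forall>x \<in> space \<Omega>. (\<lambda>n. V n x) \<longlonglongrightarrow> V0 x)"
    using Skorohod[OF real_distribution_excess_law \<pi>(1) wc]
    by (elim exE) (rule that)
  then have \<Omega>: "prob_space \<Omega>"
    and V: "\<And>n. V n \<in> measurable \<Omega> borel" "\<And>n. distr \<Omega> borel (V n) = excess_law (Y n)"
    and V0: "V0 \<in> measurable \<Omega> borel" "distr \<Omega> borel V0 = \<pi>"
    and VV0: "\<And>x. x \<in> space \<Omega> \<Longrightarrow> (\<lambda>n. V n x) \<longlonglongrightarrow> V0 x"
    by simp_all
  interpret \<Omega>: prob_space \<Omega> by fact
  note [measurable] = V(1) V0(1) g_meas g0_meas
  have "(\<lambda>n. \<integral>x. g n (V n x) \<partial>\<Omega>) \<longlonglongrightarrow> (\<integral>x. g0 (V0 x) \<partial>\<Omega>)"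
  proof (rule integral_dominated_convergence[where w="\<lambda>_. B"])
    show "AE x in \<Omega>. (\<lambda>n. g n (V n x)) \<longlonglongrightarrow> g0 (V0 x)"
      using VV0 by (auto intro!: conv)
  qed (auto simp: bound)
  moreover have "(\<integral>x. g n (V n x) \<partial>\<Omega>) = (\<integral>u. g n u \<partial>excess_law (Y n))" for n
    unfolding V(2)[symmetric] by (subst integral_distr) auto
  moreover have "(\<integral>x. g0 (V0 x) \<partial>\<Omega>) = (\<integral>u. g0 u \<partial>\<pi>)"
    unfolding V0(2)[symmetric] by (subst integral_distr) auto
  ultimately have "(\<lambda>n. (\<integral>s. g n (s / Y n) * indicator {Y n<..} s \<partial>\<mu>) / tail (Y n))
      \<longlonglongrightarrow> (\<integral>u. g0 u \<partial>\<pi>)"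
    by (simp add: integral_excess_law)
  from tendsto_mult[OF tail_scaled_tendsto[OF X b Y] this] show ?thesis
    using tail_pos[THEN less_imp_neq] by simp
qed

end

lemma tendsto_fun_coordinatewise:
  fixes F :: "'a \<Rightarrow> 'i \<Rightarrow> 'b::topological_space"
  assumes "\<And>i. ((\<lambda>x. F x i) \<longlongrightarrow> L i) net"
  shows "(F \<longlongrightarrow> L) net"
proof -
  have "limitin (product_topology (\<lambda>_. euclidean) UNIV) F L net"
    using assms by (auto simp: limitin_componentwise)
  then show ?thesis by (simp add: euclidean_product_topology)
qed

section \<open>The volatility recursion and the innovations\<close>

context garch11
begin

abbreviation fac :: "real \<Rightarrow> real" where
  "fac z \<equiv> \<alpha>1 * z\<^sup>2 + \<beta>1"

text \<open>\<open>cprod\<close> and \<open>csum\<close> are the coefficients p_k and q_k of the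
  expansion of sigma_{r+k}^2, the latter in Horner form. The indices begin at r + 1, so only
  innovations after time r occur, and these are independent of sigma_r.\<close>

definition cprod :: "int \<Rightarrow> (int \<Rightarrow> real) \<Rightarrow> nat \<Rightarrow> real" where
  "cprod r w k = (\<Prod>j<k. fac (w (r + 1 + int j)))"

primrec csum :: "int \<Rightarrow> (int \<Rightarrow> real) \<Rightarrow> nat \<Rightarrow> real" where
  "csum r w 0 = 0"
| "csum r w (Suc k) = 1 + fac (w (r + 1 + int k)) * csum r w k"

lemma fac_nonneg: "fac z \<ge> 0"
  using \<alpha>1_pos \<beta>1_nonneg by simp

lemma fac_pos: "z \<noteq> 0 \<Longrightarrow> fac z > 0"
  using \<alpha>1_pos \<beta>1_nonneg by (intro add_pos_nonneg) auto

lemma cprod_0 [simp]: "cprod r w 0 = 1"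
  and cprod_Suc [simp]: "cprod r w (Suc k) = fac (w (r + 1 + int k)) * cprod r w k"
  by (simp_all add: cprod_def mult.commute)

lemma cprod_nonneg: "cprod r w k \<ge> 0"
  unfolding cprod_def by (intro prod_nonneg ballI fac_nonneg)

lemma cprod_pos: "(\<And>j. w j \<noteq> 0) \<Longrightarrow> cprod r w k > 0"
  unfolding cprod_def by (intro prod_pos ballI fac_pos)

lemma csum_nonneg: "csum r w k \<ge> 0"
  by (induction k) (auto intro!: add_nonneg_nonneg mult_nonneg_nonneg fac_nonneg)

text \<open>With a = p + q the recursion reads a' = 1 + f a, and a >= 1 gives a' <= (1 + f) a. The
  lower bound thus drives the induction. The upper bound is a product over distinct innovations, so
  independence reduces its moments to those of one factor.\<close>

lemma cprod_csum_bound: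
  "1 \<le> cprod r w k + csum r w k \<and> cprod r w k + csum r w k \<le> (\<Prod>j<k. 1 + fac (w (r + 1 + int j)))"
proof (induction k)
  case (Suc k)
  let ?f = "fac (w (r + 1 + int k))" and ?a = "cprod r w k + csum r w k"
  have eq: "cprod r w (Suc k) + csum r w (Suc k) = 1 + ?f * ?a" by (simp add: algebra_simps)
  have f: "?f \<ge> 0" by (rule fac_nonneg)
  have "1 + ?f * ?a \<le> (1 + ?f) * ?a" using Suc by (simp add: distrib_right)
  also have "\<dots> \<le> (1 + ?f) * (\<Prod>j<k. 1 + fac (w (r + 1 + int j)))"
    using Suc f by (intro mult_left_mono) auto
  finally have "1 + ?f * ?a \<le> (\<Prod>j<Suc k. 1 + fac (w (r + 1 + int j)))"
    by (simp add: mult.commute)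
  moreover have "1 + ?f * ?a \<ge> 1" using Suc f by simp
  ultimately show ?case unfolding eq by blast
qed simp

lemma \<epsilon>_measurable [measurable]: "\<epsilon> t \<in> borel_measurable M"
  using \<epsilon>_indep by (auto simp: indep_vars_def)

lemmas [measurable] = \<zeta>_measurable \<sigma>_measurable

text \<open>Keeps every factor \<open>fac (\<epsilon> t \<omega>)\<close> positive even when
  \<open>\<beta>1\<close> is 0, so that the division by d and the reciprocal factors are
  meaningful.\<close>

lemma AE_\<epsilon>_nonzero: "AE \<omega> in M. \<forall>t. \<epsilon> t \<omega> \<noteq> 0"
proof -
  have "AE \<omega> in M. \<epsilon> t \<omega> \<noteq> 0" for t
  proof -
    have "AE z in lborel. z \<noteq> (0::real)"
      by (rule AE_lborel_singleton)
    then have "AE z in density lborel (\<lambda>x. ennreal (std_normal_density x)). z \<noteq> 0"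
      by (subst AE_density) auto
    then have "AE z in distr M lborel (\<epsilon> t). z \<noteq> 0"
      unfolding distributed_distr_eq_density[OF \<epsilon>_normal] .
    then show ?thesis by (subst (asm) AE_distr_iff) auto
  qed
  then show ?thesis by (simp add: AE_all_countable)
qed

lemma AE_\<sigma>_eq:
  "AE \<omega> in M. \<forall>t. \<sigma> t \<omega> =
     sqrt (\<alpha>0 + \<alpha>1 * (\<sigma> (t - 1) \<omega>)\<^sup>2 * (\<epsilon> t \<omega>)\<^sup>2 + \<beta>1 * (\<sigma> (t - 1) \<omega>)\<^sup>2)"
  using \<sigma>_eq by (simp add: AE_all_countable)

lemma AE_\<sigma>_sq:
  "AE \<omega> in M. \<forall>t. (\<sigma> t \<omega>)\<^sup>2 = \<alpha>0 + fac (\<epsilon> t \<omega>) * (\<sigma> (t - 1) \<omega>)\<^sup>2"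
  using AE_\<sigma>_eq
proof eventually_elim
  case (elim \<omega>)
  show ?case
  proof
    fix t
    have "\<alpha>0 + \<alpha>1 * (\<sigma> (t - 1) \<omega>)\<^sup>2 * (\<epsilon> t \<omega>)\<^sup>2 + \<beta>1 * (\<sigma> (t - 1) \<omega>)\<^sup>2 \<ge> 0"
      using \<alpha>0_pos \<alpha>1_pos \<beta>1_nonneg by (intro add_nonneg_nonneg mult_nonneg_nonneg) auto
    then show "(\<sigma> t \<omega>)\<^sup>2 = \<alpha>0 + fac (\<epsilon> t \<omega>) * (\<sigma> (t - 1) \<omega>)\<^sup>2"
      by (subst elim[rule_format]) (simp add: algebra_simps)
  qed
qed

text \<open>Serves twice: positivity recovers sigma from its square, and sigma^2 >= alpha0 lets the
  additive part of the expansion be bounded by a multiple of sigma_r^2.\<close>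

lemma AE_\<sigma>_ge: "AE \<omega> in M. \<forall>t. \<sigma> t \<omega> \<ge> sqrt \<alpha>0"
  using AE_\<sigma>_eq
proof eventually_elim
  case (elim \<omega>)
  show ?case
  proof
    fix t
    have "\<alpha>0 \<le> \<alpha>0 + \<alpha>1 * (\<sigma> (t - 1) \<omega>)\<^sup>2 * (\<epsilon> t \<omega>)\<^sup>2 + \<beta>1 * (\<sigma> (t - 1) \<omega>)\<^sup>2"
      using \<alpha>1_pos \<beta>1_nonneg by simp
    then show "sqrt \<alpha>0 \<le> \<sigma> t \<omega>"
      by (subst elim[rule_format]) simp
  qed
qed

lemma AE_\<sigma>_sq_expansion:
  "AE \<omega> in M. \<forall>k. (\<sigma> (r + int k) \<omega>)\<^sup>2 =
     (\<sigma> r \<omega>)\<^sup>2 * cprod r (\<lambda>t. \<epsilon> t \<omega>) k + \<alpha>0 * csum r (\<lambda>t. \<epsilon> t \<omega>) k"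
  using AE_\<sigma>_sq
proof eventually_elim
  case (elim \<omega>)
  show ?case
  proof
    fix k show "(\<sigma> (r + int k) \<omega>)\<^sup>2 =
     (\<sigma> r \<omega>)\<^sup>2 * cprod r (\<lambda>t. \<epsilon> t \<omega>) k + \<alpha>0 * csum r (\<lambda>t. \<epsilon> t \<omega>) k"
    proof (induction k)
      case (Suc k)
      have idx: "r + 1 + int k = r + int (Suc k)" and idx': "r + int (Suc k) - 1 = r + int k" by auto
      have "(\<sigma> (r + int (Suc k)) \<omega>)\<^sup>2 = \<alpha>0 + fac (\<epsilon> (r + int (Suc k)) \<omega>) * (\<sigma> (r + int k) \<omega>)\<^sup>2"
        by (rule elim[rule_format, of "r + int (Suc k)", unfolded idx'])
      then show ?case
        by (simp only: Suc cprod_Suc csum.simps idx) (simp only: algebra_simps mult_1_right)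
    qed simp
  qed
qed

text \<open>Transfers the tail of sigma_0 to the starting value sigma_r. Stationarity compares whole
  path laws of the pair, from which the volatility at coordinate 0 is projected out.\<close>

lemma distr_\<sigma>: "distr M borel (\<sigma> t) = distr M borel (\<sigma> 0)"
proof -
  have pair[measurable]: "(\<lambda>\<omega>. (\<zeta> t \<omega>, \<sigma> t \<omega>)) \<in> borel_measurable M" for t
    by measurable
  have eq: "distr M borel (\<sigma> h) = distr (distr M (\<Pi>\<^sub>M t\<in>UNIV. borel) (\<lambda>\<omega> t. (\<zeta> (t + h) \<omega>, \<sigma> (t + h) \<omega>)))
      borel (\<lambda>w. snd (w 0))" for h :: int
  proof (subst distr_distr)
    show "(\<lambda>w. snd (w (0::int))) \<in> (\<Pi>\<^sub>M t\<in>UNIV. (borel :: (real \<times> real) measure)) \<rightarrow>\<^sub>M (borel :: real measure)"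
      by (rule measurable_compose[where f="\<lambda>w. w 0" and N="borel :: (real \<times> real) measure" and g=snd])
         (auto intro!: measurable_component_singleton borel_measurable_continuous_onI continuous_on_snd)
    show "(\<lambda>\<omega> t. (\<zeta> (t + h) \<omega>, \<sigma> (t + h) \<omega>)) \<in> M \<rightarrow>\<^sub>M (\<Pi>\<^sub>M t\<in>UNIV. borel)"
      by (rule measurable_PiM_single') auto
  qed (simp add: comp_def)
  have "distr M (\<Pi>\<^sub>M t\<in>UNIV. borel) (\<lambda>\<omega> t. (\<zeta> (t + h) \<omega>, \<sigma> (t + h) \<omega>)) =
      distr M (\<Pi>\<^sub>M t\<in>UNIV. borel) (\<lambda>\<omega> t. (\<zeta> t \<omega>, \<sigma> t \<omega>))" for h
    using stationary unfolding strictly_stationary_def by blast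
  then show ?thesis using eq[of t] eq[of 0] by simp
qed

definition vol_law :: "real measure" where
  "vol_law = distr M borel (\<sigma> 0)"

lemma sets_vol_law [measurable_cong, simp]: "sets vol_law = sets borel"
  and space_vol_law [simp]: "space vol_law = UNIV"
  by (simp_all add: vol_law_def)

lemma real_distribution_vol_law: "real_distribution vol_law"
  unfolding vol_law_def by (rule real_distribution_distr) simp

lemma AE_vol_law_ge: "AE s in vol_law. s \<ge> sqrt \<alpha>0"
proof -
  have "AE \<omega> in M. \<sigma> 0 \<omega> \<ge> sqrt \<alpha>0" using AE_\<sigma>_ge by eventually_elim blast
  then show ?thesis unfolding vol_law_def by (subst AE_distr_iff) auto
qed

text \<open>Fubini for the starting value against the later innovations. The innovations stay in the
  outer integral, so that the limit in x can first be taken with them frozen. From the past only the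
  coordinate r is retained, whose law is the stationary one.\<close>

lemma integral_past_future:
  fixes F :: "real \<times> (int \<Rightarrow> real) \<Rightarrow> real"
  assumes F [measurable]: "F \<in> borel_measurable (borel \<Otimes>\<^sub>M (\<Pi>\<^sub>M t\<in>{r<..}. borel))"
    and B: "\<And>p. \<bar>F p\<bar> \<le> B"
  shows "(\<integral>\<omega>. F (\<sigma> r \<omega>, \<lambda>t\<in>{r<..}. \<epsilon> t \<omega>) \<partial>M)
       = (\<integral>\<omega>. (\<integral>s. F (s, \<lambda>t\<in>{r<..}. \<epsilon> t \<omega>) \<partial>vol_law) \<partial>M)"
proof -
  let ?P = "\<Pi>\<^sub>M t\<in>{r<..}. (borel :: real measure)" and ?Q = "\<Pi>\<^sub>M t\<in>{..r}. (borel :: real measure)"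
  let ?X = "\<lambda>\<omega>. \<lambda>t\<in>{r<..}. \<epsilon> t \<omega>" and ?Y = "\<lambda>\<omega>. \<lambda>t\<in>{..r}. \<sigma> t \<omega>"
  have X [measurable]: "?X \<in> M \<rightarrow>\<^sub>M ?P" and Y [measurable]: "?Y \<in> M \<rightarrow>\<^sub>M ?Q"
    by (auto intro!: measurable_restrict)
  have proj [measurable]: "(\<lambda>y. y r) \<in> ?Q \<rightarrow>\<^sub>M borel"
    by (rule measurable_component_singleton) simp
  have joint: "distr M (?P \<Otimes>\<^sub>M ?Q) (\<lambda>\<omega>. (?X \<omega>, ?Y \<omega>)) = distr M ?P ?X \<Otimes>\<^sub>M distr M ?Q ?Y"
    using future_indep[of r] by (simp add: indep_var_distribution_eq)
  interpret DX: prob_space "distr M ?P ?X" by (rule prob_space_distr) simp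
  interpret DY: prob_space "distr M ?Q ?Y" by (rule prob_space_distr) simp
  interpret P: pair_prob_space "distr M ?P ?X" "distr M ?Q ?Y" ..
  have meas: "(\<lambda>p. F (snd p r, fst p)) \<in> borel_measurable (?P \<Otimes>\<^sub>M ?Q)"
    by measurable
  have "(\<integral>\<omega>. F (\<sigma> r \<omega>, ?X \<omega>) \<partial>M) = (\<integral>p. F (snd p r, fst p) \<partial>distr M (?P \<Otimes>\<^sub>M ?Q) (\<lambda>\<omega>. (?X \<omega>, ?Y \<omega>)))"
    by (subst integral_distr) (auto intro!: meas)
  also have "\<dots> = (\<integral>w. (\<integral>y. F (y r, w) \<partial>distr M ?Q ?Y) \<partial>distr M ?P ?X)"
  proof -
    have int: "integrable (distr M ?P ?X \<Otimes>\<^sub>M distr M ?Q ?Y) (\<lambda>p. F (snd p r, fst p))"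
    proof (rule P.P.integrable_const_bound[where B=B])
      show "(\<lambda>p. F (snd p r, fst p)) \<in> borel_measurable (distr M ?P ?X \<Otimes>\<^sub>M distr M ?Q ?Y)"
        using meas by simp
    qed (use B in auto)
    show ?thesis unfolding joint using P.integral_fst'[OF int] by simp
  qed
  also have "\<dots> = (\<integral>\<omega>. (\<integral>y. F (y r, ?X \<omega>) \<partial>distr M ?Q ?Y) \<partial>M)"
    by (rule integral_distr) (auto intro!: DY.borel_measurable_lebesgue_integral)
  also have "\<dots> = (\<integral>\<omega>. (\<integral>s. F (s, ?X \<omega>) \<partial>vol_law) \<partial>M)"
  proof (rule Bochner_Integration.integral_cong[OF refl])
    fix \<omega> assume \<omega>: "\<omega> \<in> space M"
    then have "?X \<omega> \<in> space ?P" using measurable_space[OF X] by blast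
    then have [measurable]: "(\<lambda>s. F (s, ?X \<omega>)) \<in> borel_measurable borel"
      by measurable
    have law: "distr (distr M ?Q ?Y) borel (\<lambda>y. y r) = vol_law"
      unfolding vol_law_def distr_\<sigma>[of r, symmetric] by (subst distr_distr) (auto simp: comp_def)
    have "(\<integral>s. F (s, ?X \<omega>) \<partial>distr (distr M ?Q ?Y) borel (\<lambda>y. y r)) = (\<integral>y. F (y r, ?X \<omega>) \<partial>distr M ?Q ?Y)"
      by (rule integral_distr) auto
    then show "(\<integral>y. F (y r, ?X \<omega>) \<partial>distr M ?Q ?Y) = (\<integral>s. F (s, ?X \<omega>) \<partial>vol_law)"
      unfolding law ..
  qed
  finally show ?thesis .
qed

text \<open>The polynomial is a common majorant of 1 + \<open>fac z\<close> and 1 + z^2, the two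
  kinds of factors in the domination; K will be the exponent of the Potter bound. The binomial
  expansion leaves normal moments of even order.\<close>

lemma integrable_\<epsilon>_polynomial: "integrable M (\<lambda>\<omega>. (1 + \<beta>1 + (1 + \<alpha>1) * (\<epsilon> t \<omega>)\<^sup>2) ^ K)"
proof -
  have "std_normal_density z * (a + c * z\<^sup>2) ^ K =
      (\<Sum>k\<le>K. real (K choose k) * a ^ k * c ^ (K - k) * (std_normal_density z * z ^ (2 * (K - k))))"
    for a c z :: real
    unfolding binomial_ring power_mult
    by (simp add: sum_distrib_left power_mult_distrib mult_ac)
  note eq = this[of _ "1 + \<beta>1" "1 + \<alpha>1"]
  have "integrable lborel (\<lambda>z. std_normal_density z * (1 + \<beta>1 + (1 + \<alpha>1) * z\<^sup>2) ^ K)"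
    unfolding eq by (intro Bochner_Integration.integrable_sum integrable_mult_right integrable_std_normal_moment)
  then show ?thesis
    by (subst (asm) distributed_integrable[OF \<epsilon>_normal[of t]]) auto
qed

lemma integrable_\<epsilon>_prod:
  assumes "finite J"
  shows "integrable M (\<lambda>\<omega>. \<Prod>t\<in>J. (1 + \<beta>1 + (1 + \<alpha>1) * (\<epsilon> t \<omega>)\<^sup>2) ^ K)"
proof (rule indep_vars_integrable[OF assms _ integrable_\<epsilon>_polynomial])
  show "indep_vars (\<lambda>_. borel) (\<lambda>t \<omega>. (1 + \<beta>1 + (1 + \<alpha>1) * (\<epsilon> t \<omega>)\<^sup>2) ^ K) J"
    by (rule indep_vars_compose2[OF indep_vars_subset[OF \<epsilon>_indep]]) auto
qed

end

section \<open>Paths as functionals of a starting volatility and the innovations\<close>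

lemma borel_measurable_continuous_restrict:
  fixes f :: "(int \<Rightarrow> real) \<Rightarrow> real"
  assumes f: "continuous_on UNIV f" and h: "\<And>t. t \<in> I \<Longrightarrow> h t \<in> borel_measurable N"
  shows "(\<lambda>p. f (\<lambda>t\<in>I. h t p)) \<in> borel_measurable N"
proof (rule measurable_compose[OF _ borel_measurable_continuous_onI[OF f]])
  show "(\<lambda>p. \<lambda>t\<in>I. h t p) \<in> borel_measurable N"
  proof (rule measurable_coordinatewise_then_product)
    fix t show "(\<lambda>p. (\<lambda>t\<in>I. h t p) t) \<in> borel_measurable N"
      by (cases "t \<in> I") (simp_all add: h)
  qed
qed

lemma AE_pareto_gt_1:
  assumes "real_distribution \<pi>" "\<And>x. x \<ge> 1 \<Longrightarrow> measure \<pi> {x<..} = x powr (- \<kappa>)"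
  shows "AE z in \<pi>. z > (1::real)"
proof -
  interpret real_distribution \<pi> by fact
  have "prob {1<..} = 1" using assms(2)[of 1] by simp
  from AE_prob_1[OF this] show ?thesis by simp
qed

context garch11
begin

lemma cprod_restrict [simp]: "cprod r (\<lambda>t\<in>{r<..}. w t) k = cprod r w k"
  by (simp add: cprod_def)

lemma csum_restrict [simp]: "csum r (\<lambda>t\<in>{r<..}. w t) k = csum r w k"
  by (induction k) simp_all

lemma measurable_cprod [measurable]: "(\<lambda>w. cprod r w k) \<in> borel_measurable (\<Pi>\<^sub>M t\<in>{r<..}. borel)"
proof -
  have [measurable]: "(\<lambda>w. w (r + 1 + int j)) \<in> borel_measurable (\<Pi>\<^sub>M t\<in>{r<..}. (borel :: real measure))" for j
    by (rule measurable_component_singleton) simp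
  show ?thesis unfolding cprod_def by measurable
qed

lemma measurable_csum [measurable]: "(\<lambda>w. csum r w k) \<in> borel_measurable (\<Pi>\<^sub>M t\<in>{r<..}. borel)"
proof (induction k)
  case (Suc k)
  note Suc[measurable]
  have [measurable]: "(\<lambda>w. w (r + 1 + int k)) \<in> borel_measurable (\<Pi>\<^sub>M t\<in>{r<..}. (borel :: real measure))"
    by (rule measurable_component_singleton) simp
  show ?case by simp
qed simp

text \<open>The expansion of sigma_t / x with s in the place of sigma_r and w in the place of the
  innovations. It represents the volatility only for t >= r; for smaller t \<open>nat\<close> would
  cut the difference off at 0.\<close>

definition vol_path :: "int \<Rightarrow> int set \<Rightarrow> real \<Rightarrow> real \<Rightarrow> (int \<Rightarrow> real) \<Rightarrow> int \<Rightarrow> real" where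
  "vol_path r I x s w = (\<lambda>t\<in>I. sqrt (s\<^sup>2 * cprod r w (nat (t - r)) + \<alpha>0 * csum r w (nat (t - r))) / x)"

text \<open>The event |zeta_0| > x in squared form: zeta_0 = sigma_0 epsilon_1, so sigma_0^2 is
  expanded over - r steps and w 1 is the innovation after time 0.\<close>

definition exceeds :: "int \<Rightarrow> real \<Rightarrow> real \<Rightarrow> (int \<Rightarrow> real) \<Rightarrow> bool" where
  "exceeds r x s w \<longleftrightarrow> x\<^sup>2 < (s\<^sup>2 * cprod r w (nat (- r)) + \<alpha>0 * csum r w (nat (- r))) * (w 1)\<^sup>2"

lemma measurable_path_functional:
  fixes f :: "(int \<Rightarrow> real) \<Rightarrow> real"
  assumes f: "continuous_on UNIV f" and r: "r \<le> 0"
    and g [measurable]: "g \<in> borel_measurable N" and h: "h \<in> N \<rightarrow>\<^sub>M (\<Pi>\<^sub>M t\<in>{r<..}. borel)"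
  shows "(\<lambda>p. f (vol_path r I x (g p) (h p)) * of_bool (exceeds r x (g p) (h p))) \<in> borel_measurable N"
proof -
  have "(\<lambda>w. w 1) \<in> borel_measurable (\<Pi>\<^sub>M t\<in>{r<..}. (borel :: real measure))"
    by (rule measurable_component_singleton) (use r in simp)
  note [measurable] = measurable_compose[OF h this] measurable_compose[OF h measurable_cprod]
    measurable_compose[OF h measurable_csum]
  have [measurable]: "(\<lambda>p. f (vol_path r I x (g p) (h p))) \<in> borel_measurable N"
    unfolding vol_path_def by (rule borel_measurable_continuous_restrict[OF f]) measurable
  show ?thesis unfolding exceeds_def of_bool_def by measurable
qed

lemma integral_path_functional:
  fixes f :: "(int \<Rightarrow> real) \<Rightarrow> real"
  assumes f: "continuous_on UNIV f" and B: "\<And>y. \<bar>f y\<bar> \<le> B" and r: "r \<le> 0"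
    and I: "I \<subseteq> {r..}" and x: "x > 0"
  shows "(\<integral>\<omega>. f (\<lambda>t\<in>I. \<sigma> t \<omega> / x) * indicator {\<omega> \<in> space M. \<bar>\<zeta> 0 \<omega>\<bar> > x} \<omega> \<partial>M) =
    (\<integral>\<omega>. (\<integral>s. f (vol_path r I x s (\<lambda>t. \<epsilon> t \<omega>)) * of_bool (exceeds r x s (\<lambda>t. \<epsilon> t \<omega>)) \<partial>vol_law) \<partial>M)"
proof -
  let ?F = "\<lambda>p. f (vol_path r I x (fst p) (snd p)) * of_bool (exceeds r x (fst p) (snd p))"
  have meas: "?F \<in> borel_measurable (borel \<Otimes>\<^sub>M (\<Pi>\<^sub>M t\<in>{r<..}. borel))"
    by (rule measurable_path_functional[OF f r]) measurable
  have bnd: "\<bar>?F p\<bar> \<le> B" for p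
  proof -
    have "0 \<le> B" using B[of "\<lambda>_. 0"] by linarith
    then show ?thesis using B[of "vol_path r I x (fst p) (snd p)"] by (simp add: of_bool_def)
  qed
  have restr: "?F (s, \<lambda>t\<in>{r<..}. \<epsilon> t \<omega>) =
      f (vol_path r I x s (\<lambda>t. \<epsilon> t \<omega>)) * of_bool (exceeds r x s (\<lambda>t. \<epsilon> t \<omega>))" for s \<omega>
    using r by (simp add: vol_path_def exceeds_def)
  have [measurable]: "(\<lambda>\<omega>. f (\<lambda>t\<in>I. \<sigma> t \<omega> / x)) \<in> borel_measurable M"
    by (rule borel_measurable_continuous_restrict[OF f]) measurable
  have [measurable]: "(\<lambda>\<omega>. \<lambda>t\<in>{r<..}. \<epsilon> t \<omega>) \<in> M \<rightarrow>\<^sub>M (\<Pi>\<^sub>M t\<in>{r<..}. borel)"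
    by (rule measurable_restrict) simp
  have AE_\<zeta>: "AE \<omega> in M. \<zeta> 0 \<omega> = \<sigma> 0 \<omega> * \<epsilon> (0 + 1) \<omega>" by (rule \<zeta>_eq)
  have "(\<integral>\<omega>. f (\<lambda>t\<in>I. \<sigma> t \<omega> / x) * indicator {\<omega> \<in> space M. \<bar>\<zeta> 0 \<omega>\<bar> > x} \<omega> \<partial>M) =
      (\<integral>\<omega>. ?F (\<sigma> r \<omega>, \<lambda>t\<in>{r<..}. \<epsilon> t \<omega>) \<partial>M)"
  proof (rule integral_cong_AE)
    show "AE \<omega> in M. f (\<lambda>t\<in>I. \<sigma> t \<omega> / x) * indicator {\<omega> \<in> space M. \<bar>\<zeta> 0 \<omega>\<bar> > x} \<omega> =
        ?F (\<sigma> r \<omega>, \<lambda>t\<in>{r<..}. \<epsilon> t \<omega>)"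
      using AE_\<sigma>_sq_expansion[of r] AE_\<sigma>_ge AE_\<zeta> AE_space
    proof eventually_elim
      case (elim \<omega>)
      have \<sigma>: "\<sigma> t \<omega> = sqrt ((\<sigma> r \<omega>)\<^sup>2 * cprod r (\<lambda>t. \<epsilon> t \<omega>) (nat (t - r)) + \<alpha>0 * csum r (\<lambda>t. \<epsilon> t \<omega>) (nat (t - r)))"
        if "t \<ge> r" for t
      proof -
        have "0 \<le> sqrt \<alpha>0" using \<alpha>0_pos by simp
        also have "\<dots> \<le> \<sigma> t \<omega>" using elim(2) by blast
        finally have "\<sigma> t \<omega> = sqrt ((\<sigma> (r + int (nat (t - r))) \<omega>)\<^sup>2)" using that by simp
        then show ?thesis by (simp only: elim(1)[rule_format])
      qed
      have path: "(\<lambda>t\<in>I. \<sigma> t \<omega> / x) = vol_path r I x (\<sigma> r \<omega>) (\<lambda>t. \<epsilon> t \<omega>)"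
        unfolding vol_path_def
      proof (rule restrict_ext)
        fix t assume "t \<in> I"
        with I have "t \<ge> r" by auto
        from \<sigma>[OF this] show "\<sigma> t \<omega> / x = sqrt ((\<sigma> r \<omega>)\<^sup>2 * cprod r (\<lambda>t. \<epsilon> t \<omega>) (nat (t - r)) +
            \<alpha>0 * csum r (\<lambda>t. \<epsilon> t \<omega>) (nat (t - r))) / x"
          by (rule arg_cong)
      qed
      have "x < \<bar>\<zeta> 0 \<omega>\<bar> \<longleftrightarrow> x\<^sup>2 < (\<zeta> 0 \<omega>)\<^sup>2"
        using x abs_le_square_iff[of "\<zeta> 0 \<omega>" x] by (simp add: not_le[symmetric])
      also have "(\<zeta> 0 \<omega>)\<^sup>2 = (\<sigma> (r + int (nat (- r))) \<omega>)\<^sup>2 * (\<epsilon> 1 \<omega>)\<^sup>2"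
        using elim(3) r by (simp add: power_mult_distrib)
      finally have "x < \<bar>\<zeta> 0 \<omega>\<bar> \<longleftrightarrow> exceeds r x (\<sigma> r \<omega>) (\<lambda>t. \<epsilon> t \<omega>)"
        unfolding exceeds_def by (simp only: elim(1)[rule_format])
      then show ?case
        unfolding restr path using elim(4) by (simp add: indicator_def)
    qed
    show "(\<lambda>\<omega>. ?F (\<sigma> r \<omega>, \<lambda>t\<in>{r<..}. \<epsilon> t \<omega>)) \<in> borel_measurable M"
      by (rule measurable_compose[OF _ meas]) measurable
  qed measurable
  also have "\<dots> = (\<integral>\<omega>. (\<integral>s. ?F (s, \<lambda>t\<in>{r<..}. \<epsilon> t \<omega>) \<partial>vol_law) \<partial>M)"
    by (rule integral_past_future[OF meas bnd])
  finally show ?thesis unfolding restr .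
qed

end

section \<open>Limits for frozen innovations and dominated convergence\<close>

locale garch11_regvar = garch11 +
  assumes reg_var: "\<And>u. u > 0 \<Longrightarrow>
    ((\<lambda>x. measure M {\<omega> \<in> space M. \<sigma> 0 \<omega> > u * x} / measure M {\<omega> \<in> space M. \<sigma> 0 \<omega> > x})
       \<longlongrightarrow> u powr (- 2 * \<alpha>)) at_top"
begin

lemma measure_vol_law_tail: "measure vol_law {x<..} = measure M {\<omega> \<in> space M. \<sigma> 0 \<omega> > x}"
  unfolding vol_law_def by (subst measure_distr) (auto intro!: arg_cong[where f="measure M"])

sublocale V: regularly_varying_tail vol_law "2 * \<alpha>"
proof -
  interpret V: real_distribution vol_law by (rule real_distribution_vol_law)
  show "regularly_varying_tail vol_law (2 * \<alpha>)"
    by unfold_locales (use reg_var in \<open>simp_all add: measure_vol_law_tail real_distribution_vol_law\<close>)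
qed

text \<open>For fixed w the condition \<open>exceeds\<close> is linear in s^2 and hence equivalent
  to s > Y with Y / x tending to 1 / d, which reduces everything to excesses over Y. The factor (1 /
  d) to the power -2 alpha is the weight d^(2 alpha). In the limit the additive terms are lost,
  because they stay bounded while x grows.\<close>

lemma path_functional_tendsto:
  fixes f :: "(int \<Rightarrow> real) \<Rightarrow> real"
    and r :: int
  assumes f: "continuous_on UNIV f" and B: "\<And>y. \<bar>f y\<bar> \<le> B"
    and w: "\<And>t. w t \<noteq> 0"
    and \<pi>: "real_distribution \<pi>" "\<And>x. x \<ge> 1 \<Longrightarrow> measure \<pi> {x<..} = x powr (- (2 * \<alpha>))"
  defines "d \<equiv> sqrt (cprod r w (nat (- r))) * \<bar>w 1\<bar>"
  shows "((\<lambda>x. (\<integral>s. f (vol_path r I x s w) * of_bool (exceeds r x s w) \<partial>vol_law) / V.tail x)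
     \<longlongrightarrow> d powr (2 * \<alpha>) * (\<integral>z. f (\<lambda>t\<in>I. z * sqrt (cprod r w (nat (t - r))) / d) \<partial>\<pi>)) at_top"
proof (rule tendsto_at_topI_sequentially)
  \<comment> \<open>Skorohod's theorem concerns sequences, so the limit is tested along an arbitrary
    sequence tending to infinity.\<close>
  fix X :: "nat \<Rightarrow> real" assume X: "filterlim X at_top sequentially"
  define p where "p t = cprod r w (nat (t - r))" for t
  define c where "c t = \<alpha>0 * csum r w (nat (t - r))" for t
  \<comment> \<open>The positive solution s of x^2 = (s^2 p_0 + c_0) w_1^2 at x = X n.\<close>
  define Y where "Y n = sqrt (((X n)\<^sup>2 / (w 1)\<^sup>2 - c 0) / p 0)" for n
  have p: "p t > 0" for t unfolding p_def by (rule cprod_pos[OF w])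
  have c: "c t \<ge> 0" for t unfolding c_def using \<alpha>0_pos csum_nonneg by simp
  have d: "d > 0" "d = sqrt (p 0) * \<bar>w 1\<bar>" using p[of 0] w[of 1] by (simp_all add: d_def p_def)
  have evX: "eventually (\<lambda>n. X n > K) sequentially" for K
    using X by (simp add: filterlim_at_top_dense)
  have X2: "(\<lambda>n. k / (X n)\<^sup>2) \<longlonglongrightarrow> 0" for k
    by (rule tendsto_divide_0[OF tendsto_const])
       (intro filterlim_at_top_imp_at_infinity filterlim_pow_at_top X; simp)
  have YX: "(\<lambda>n. Y n / X n) \<longlonglongrightarrow> 1 / d"
  proof -
    have "(\<lambda>n. sqrt ((1 / (w 1)\<^sup>2 - c 0 / (X n)\<^sup>2) / p 0)) \<longlonglongrightarrow> sqrt ((1 / (w 1)\<^sup>2 - 0) / p 0)"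
      using p[of 0] by (intro tendsto_intros X2) auto
    also have "sqrt ((1 / (w 1)\<^sup>2 - 0) / p 0) = 1 / d"
      unfolding d by (simp add: real_sqrt_divide real_sqrt_mult mult.commute)
    finally show ?thesis
    proof (rule Lim_transform_eventually)
      show "\<forall>\<^sub>F n in sequentially. sqrt ((1 / (w 1)\<^sup>2 - c 0 / (X n)\<^sup>2) / p 0) = Y n / X n"
        using evX[of 0]
      proof eventually_elim
        case (elim n)
        have "Y n / X n = sqrt (((X n)\<^sup>2 / (w 1)\<^sup>2 - c 0) / p 0) / sqrt ((X n)\<^sup>2)"
          using elim by (simp add: Y_def)
        also have "\<dots> = sqrt ((((X n)\<^sup>2 / (w 1)\<^sup>2 - c 0) / p 0) / (X n)\<^sup>2)"
          by (simp only: real_sqrt_divide)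
        also have "(((X n)\<^sup>2 / (w 1)\<^sup>2 - c 0) / p 0) / (X n)\<^sup>2 = (1 / (w 1)\<^sup>2 - c 0 / (X n)\<^sup>2) / p 0"
          using elim p[of 0] w[of 1] by (simp add: field_simps)
        finally show ?case by simp
      qed
    qed
  qed
  define g where "g n u = f (\<lambda>t\<in>I. sqrt ((u * Y n)\<^sup>2 * p t + c t) / X n)" for n u
  define g0 where "g0 u = f (\<lambda>t\<in>I. \<bar>u\<bar> * sqrt (p t) / d)" for u
  have conv: "(\<lambda>n. g n (v n)) \<longlonglongrightarrow> g0 u" if v: "v \<longlonglongrightarrow> u" for v u
  proof -
    have comp: "(\<lambda>n. sqrt ((v n * Y n)\<^sup>2 * p t + c t) / X n) \<longlonglongrightarrow> \<bar>u\<bar> * sqrt (p t) / d" for t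
    proof -
      have "(\<lambda>n. sqrt ((v n * (Y n / X n))\<^sup>2 * p t + c t / (X n)\<^sup>2)) \<longlonglongrightarrow> sqrt ((u * (1 / d))\<^sup>2 * p t + 0)"
        by (intro tendsto_intros v YX X2)
      also have "sqrt ((u * (1 / d))\<^sup>2 * p t + 0) = \<bar>u\<bar> * sqrt (p t) / d"
        using d(1) by (simp add: real_sqrt_mult real_sqrt_divide power_divide)
      finally show ?thesis
      proof (rule Lim_transform_eventually)
        show "\<forall>\<^sub>F n in sequentially. sqrt ((v n * (Y n / X n))\<^sup>2 * p t + c t / (X n)\<^sup>2) =
            sqrt ((v n * Y n)\<^sup>2 * p t + c t) / X n"
          using evX[of 0]
        proof eventually_elim
          case (elim n)
          have "sqrt ((v n * Y n)\<^sup>2 * p t + c t) / X n = sqrt (((v n * Y n)\<^sup>2 * p t + c t) / (X n)\<^sup>2)"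
            using elim by (simp add: real_sqrt_divide)
          also have "((v n * Y n)\<^sup>2 * p t + c t) / (X n)\<^sup>2 = (v n * (Y n / X n))\<^sup>2 * p t + c t / (X n)\<^sup>2"
            by (simp add: add_divide_distrib power_mult_distrib power_divide)
          finally show ?case by simp
        qed
      qed
    qed
    have "(\<lambda>n. \<lambda>t\<in>I. sqrt ((v n * Y n)\<^sup>2 * p t + c t) / X n) \<longlonglongrightarrow> (\<lambda>t\<in>I. \<bar>u\<bar> * sqrt (p t) / d)"
    proof (rule tendsto_fun_coordinatewise)
      fix t
      show "(\<lambda>n. (\<lambda>t\<in>I. sqrt ((v n * Y n)\<^sup>2 * p t + c t) / X n) t)
          \<longlonglongrightarrow> (\<lambda>t\<in>I. \<bar>u\<bar> * sqrt (p t) / d) t"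
        by (cases "t \<in> I") (simp_all add: comp)
    qed
    then show ?thesis unfolding g_def g0_def
      by (rule continuous_on_tendsto_compose[OF f]) auto
  qed
  have lim: "(\<lambda>n. (\<integral>s. g n (s / Y n) * indicator {Y n<..} s \<partial>vol_law) / V.tail (X n))
      \<longlonglongrightarrow> (1 / d) powr (- (2 * \<alpha>)) * (\<integral>u. g0 u \<partial>\<pi>)"
  proof (rule V.excess_functional_tendsto[OF X _ YX \<pi> _ _ _ conv])
    show "g n \<in> borel_measurable borel" for n
      unfolding g_def by (rule borel_measurable_continuous_restrict[OF f]) measurable
    show "g0 \<in> borel_measurable borel"
      unfolding g0_def by (rule borel_measurable_continuous_restrict[OF f]) measurable
    show "\<bar>g n u\<bar> \<le> B" for n u unfolding g_def by (rule B)
  qed (use d in auto)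
  have gt1: "AE z in \<pi>. z > 1" using \<pi> by (rule AE_pareto_gt_1)
  have "(\<integral>u. g0 u \<partial>\<pi>) = (\<integral>z. f (\<lambda>t\<in>I. z * sqrt (p t) / d) \<partial>\<pi>)"
  proof (rule integral_cong_AE)
    interpret \<pi>: real_distribution \<pi> by fact
    show "g0 \<in> borel_measurable \<pi>"
      unfolding g0_def by (rule borel_measurable_continuous_restrict[OF f]) measurable
    show "(\<lambda>z. f (\<lambda>t\<in>I. z * sqrt (p t) / d)) \<in> borel_measurable \<pi>"
      by (rule borel_measurable_continuous_restrict[OF f]) measurable
    show "AE z in \<pi>. g0 z = f (\<lambda>t\<in>I. z * sqrt (p t) / d)"
      using gt1 by eventually_elim (simp add: g0_def)
  qed
  moreover have "(1 / d) powr (- (2 * \<alpha>)) = d powr (2 * \<alpha>)"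
    using d by (simp add: powr_divide powr_minus)
  moreover have "\<forall>\<^sub>F n in sequentially. (\<integral>s. g n (s / Y n) * indicator {Y n<..} s \<partial>vol_law) / V.tail (X n) =
      (\<integral>s. f (vol_path r I (X n) s w) * of_bool (exceeds r (X n) s w) \<partial>vol_law) / V.tail (X n)"
    \<comment> \<open>Beyond this bound X n > 1, so (X n)^2 >= X n > c_0 w_1^2, and the radicand of
      Y n is positive.\<close>
    using evX[of "1 + c 0 * (w 1)\<^sup>2"]
  proof eventually_elim
    case (elim n)
    have w2: "(w 1)\<^sup>2 > 0" using w by simp
    have "c 0 * (w 1)\<^sup>2 \<ge> 0" using c by simp
    then have X1: "X n > 1" using elim by linarith
    have "c 0 * (w 1)\<^sup>2 < X n" using elim by linarith
    also have "X n \<le> (X n)\<^sup>2" using X1 by (simp add: power2_eq_square)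
    finally have "c 0 < (X n)\<^sup>2 / (w 1)\<^sup>2" using w2 by (simp add: field_simps)
    then have Ypos: "Y n > 0" unfolding Y_def using p[of 0] by simp
    have Ysq: "(Y n)\<^sup>2 = ((X n)\<^sup>2 / (w 1)\<^sup>2 - c 0) / p 0"
      unfolding Y_def using \<open>c 0 < _\<close> p[of 0] by (intro real_sqrt_pow2) simp
    have "(\<integral>s. g n (s / Y n) * indicator {Y n<..} s \<partial>vol_law) =
      (\<integral>s. f (vol_path r I (X n) s w) * of_bool (exceeds r (X n) s w) \<partial>vol_law)"
    proof (rule integral_cong_AE)
      show "AE s in vol_law. g n (s / Y n) * indicator {Y n<..} s =
          f (vol_path r I (X n) s w) * of_bool (exceeds r (X n) s w)"
        using AE_vol_law_ge
      proof eventually_elim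
        case (elim s)
        have "0 < sqrt \<alpha>0" using \<alpha>0_pos by simp
        with elim have s: "s > 0" by linarith
        have "exceeds r (X n) s w \<longleftrightarrow> (X n)\<^sup>2 < (s\<^sup>2 * p 0 + c 0) * (w 1)\<^sup>2"
          by (simp add: exceeds_def p_def c_def)
        also have "\<dots> \<longleftrightarrow> (Y n)\<^sup>2 < s\<^sup>2"
          unfolding Ysq using w2 p[of 0] by (simp add: field_simps)
        also have "\<dots> \<longleftrightarrow> Y n < s"
          using s Ypos by (auto intro: power_strict_mono dest: power2_less_imp_less)
        finally have e: "exceeds r (X n) s w \<longleftrightarrow> Y n < s" .
        have "g n (s / Y n) = f (vol_path r I (X n) s w)"
          using Ypos by (simp add: g_def vol_path_def p_def c_def)
        then show ?case unfolding e by (simp add: indicator_def)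
      qed
      have gm: "g n \<in> borel_measurable borel"
        unfolding g_def by (rule borel_measurable_continuous_restrict[OF f]) measurable
      note [measurable] = gm
      show "(\<lambda>s. g n (s / Y n) * indicator {Y n<..} s) \<in> borel_measurable vol_law"
        by measurable
      have [measurable]: "(\<lambda>s. f (vol_path r I (X n) s w)) \<in> borel_measurable vol_law"
        unfolding vol_path_def by (rule borel_measurable_continuous_restrict[OF f]) measurable
      show "(\<lambda>s. f (vol_path r I (X n) s w) * of_bool (exceeds r (X n) s w)) \<in> borel_measurable vol_law"
        unfolding exceeds_def of_bool_def by measurable
    qed
    then show ?case by simp
  qed
  ultimately show "(\<lambda>n. (\<integral>s. f (vol_path r I (X n) s w) * of_bool (exceeds r (X n) s w) \<partial>vol_law) / V.tail (X n))
      \<longlonglongrightarrow> d powr (2 * \<alpha>) * (\<integral>z. f (\<lambda>t\<in>I. z * sqrt (cprod r w (nat (t - r))) / d) \<partial>\<pi>)"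
    using Lim_transform_eventually[OF lim] by (simp add: p_def)
qed

text \<open>Replacing alpha0 by the larger s^2 turns the exceedance into x^2 < s^2 R with R = (p +
  q) w_1^2. From R <= (1 + R)^2 follows s > x / (1 + R), and the divisor 1 + R is at least 1, as the
  Potter bound demands.\<close>

lemma path_functional_bound:
  fixes f :: "(int \<Rightarrow> real) \<Rightarrow> real"
  assumes B: "\<And>y. \<bar>f y\<bar> \<le> B"
  shows "\<bar>\<integral>s. f (vol_path r I x s w) * of_bool (exceeds r x s w) \<partial>vol_law\<bar>
    \<le> B * V.tail (x / (1 + (cprod r w (nat (- r)) + csum r w (nat (- r))) * (w 1)\<^sup>2))"
proof -
  define R where "R = (cprod r w (nat (- r)) + csum r w (nat (- r))) * (w 1)\<^sup>2"
  have R: "R \<ge> 0" unfolding R_def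
    by (intro mult_nonneg_nonneg add_nonneg_nonneg cprod_nonneg csum_nonneg) simp
  have B0: "B \<ge> 0" using B[of undefined] by linarith
  have "AE s in vol_law. norm (f (vol_path r I x s w) * of_bool (exceeds r x s w))
      \<le> B * indicator {x / (1 + R)<..} s"
    using AE_vol_law_ge
  proof eventually_elim
    case (elim s)
    have "0 < sqrt \<alpha>0" using \<alpha>0_pos by simp
    with elim have s: "s > 0" by linarith
    have "(sqrt \<alpha>0)\<^sup>2 \<le> s\<^sup>2" using elim \<alpha>0_pos by (intro power_mono) auto
    then have s2: "\<alpha>0 \<le> s\<^sup>2" using \<alpha>0_pos by simp
    have "x / (1 + R) < s" if "exceeds r x s w"
    proof -
      have "x\<^sup>2 < (s\<^sup>2 * cprod r w (nat (- r)) + \<alpha>0 * csum r w (nat (- r))) * (w 1)\<^sup>2"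
        using that by (simp add: exceeds_def)
      also have "\<dots> \<le> (s\<^sup>2 * cprod r w (nat (- r)) + s\<^sup>2 * csum r w (nat (- r))) * (w 1)\<^sup>2"
        using s2 by (intro mult_right_mono add_left_mono csum_nonneg) auto
      also have "\<dots> = s\<^sup>2 * R" by (simp add: R_def algebra_simps)
      also have "\<dots> \<le> s\<^sup>2 * (1 + R)\<^sup>2"
        using R by (intro mult_left_mono) (auto simp: power2_eq_square algebra_simps)
      finally have "x\<^sup>2 < (s * (1 + R))\<^sup>2" by (simp add: power_mult_distrib)
      then have "x < s * (1 + R)" by (rule power2_less_imp_less) (use s R in auto)
      then show ?thesis using R by (simp add: field_simps)
    qed
    then show ?case using B[of "vol_path r I x s w"] B0 by (auto simp: indicator_def)
  qed
  then have "(\<integral>s. norm (f (vol_path r I x s w) * of_bool (exceeds r x s w)) \<partial>vol_law)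
      \<le> (\<integral>s. B * indicator {x / (1 + R)<..} s \<partial>vol_law)"
    by (intro integral_mono_AE') (auto simp: V.emeasure_finite less_top[symmetric])
  with integral_norm_bound[of vol_law "\<lambda>s. f (vol_path r I x s w) * of_bool (exceeds r x s w)"]
  have "norm (\<integral>s. f (vol_path r I x s w) * of_bool (exceeds r x s w) \<partial>vol_law)
      \<le> (\<integral>s. B * indicator {x / (1 + R)<..} s \<partial>vol_law)"
    by (rule order_trans)
  then show ?thesis by (simp add: R_def)
qed

text \<open>Dominated convergence over the innovations. The Potter bound gives a K-th power of 1 +
  (p + q) epsilon_1^2, which is at most a product of K-th powers of quadratic polynomials in
  distinct innovations, integrable by independence.\<close>

lemma tail_functional_tendsto:
  fixes f :: "(int \<Rightarrow> real) \<Rightarrow> real" and r :: int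
  assumes f: "continuous_on UNIV f" and B: "\<And>y. \<bar>f y\<bar> \<le> B" and r: "r \<le> 0" and I: "I \<subseteq> {r..}"
    and \<pi>: "real_distribution \<pi>" "\<And>x. x \<ge> 1 \<Longrightarrow> measure \<pi> {x<..} = x powr (- (2 * \<alpha>))"
  defines "d \<equiv> \<lambda>\<omega>. sqrt (cprod r (\<lambda>t. \<epsilon> t \<omega>) (nat (- r))) * \<bar>\<epsilon> 1 \<omega>\<bar>"
  shows "((\<lambda>x. (\<integral>\<omega>. f (\<lambda>t\<in>I. \<sigma> t \<omega> / x) * indicator {\<omega> \<in> space M. \<bar>\<zeta> 0 \<omega>\<bar> > x} \<omega> \<partial>M) / V.tail x)
     \<longlongrightarrow> (\<integral>\<omega>. d \<omega> powr (2 * \<alpha>) *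
           (\<integral>z. f (\<lambda>t\<in>I. z * sqrt (cprod r (\<lambda>t. \<epsilon> t \<omega>) (nat (t - r))) / d \<omega>) \<partial>\<pi>) \<partial>M)) at_top"
proof -
  define J where "J x \<omega> = (\<integral>s. f (vol_path r I x s (\<lambda>t. \<epsilon> t \<omega>)) *
      of_bool (exceeds r x s (\<lambda>t. \<epsilon> t \<omega>)) \<partial>vol_law)" for x \<omega>
  define L where "L \<omega> = d \<omega> powr (2 * \<alpha>) *
      (\<integral>z. f (\<lambda>t\<in>I. z * sqrt (cprod r (\<lambda>t. \<epsilon> t \<omega>) (nat (t - r))) / d \<omega>) \<partial>\<pi>)" for \<omega>
  define D where "D z = 1 + \<beta>1 + (1 + \<alpha>1) * z\<^sup>2" for z
  obtain C x0 :: real and K :: nat where C: "C \<ge> 1" and x0: "x0 > 0" and potter: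
    "\<And>x u. x \<ge> x0 \<Longrightarrow> u \<ge> 1 \<Longrightarrow> V.tail (x / u) \<le> C * u ^ K * V.tail x"
    using V.tail_potter by blast
  interpret \<pi>: real_distribution \<pi> by fact
  have B0: "B \<ge> 0" using B[of "\<lambda>_. 0"] by linarith
  have \<epsilon>_restrict [measurable]: "(\<lambda>\<omega>. \<lambda>t\<in>{r<..}. \<epsilon> t \<omega>) \<in> M \<rightarrow>\<^sub>M (\<Pi>\<^sub>M t\<in>{r<..}. borel)"
    by (rule measurable_restrict) simp
  have cprod_meas [measurable]: "(\<lambda>\<omega>. cprod r (\<lambda>t. \<epsilon> t \<omega>) k) \<in> borel_measurable M" for k
    using measurable_compose[OF \<epsilon>_restrict measurable_cprod[of r k]] by simp
  have J_meas: "J x \<in> borel_measurable M" for x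
  proof -
    have "(\<lambda>w. \<integral>s. f (vol_path r I x s w) * of_bool (exceeds r x s w) \<partial>vol_law)
        \<in> borel_measurable (\<Pi>\<^sub>M t\<in>{r<..}. borel)"
      by (rule V.borel_measurable_lebesgue_integral)
         (unfold case_prod_beta', rule measurable_path_functional[OF f r], measurable)
    from measurable_compose[OF \<epsilon>_restrict this] show ?thesis
      using r by (simp add: J_def[abs_def] vol_path_def exceeds_def)
  qed
  have "((\<lambda>x. \<integral>\<omega>. J x \<omega> / V.tail x \<partial>M) \<longlongrightarrow> (\<integral>\<omega>. L \<omega> \<partial>M)) at_top"
  proof (rule integral_dominated_convergence_at_top)
    show "AE \<omega> in M. ((\<lambda>x. J x \<omega> / V.tail x) \<longlongrightarrow> L \<omega>) at_top"
      using AE_\<epsilon>_nonzero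
    proof eventually_elim
      case (elim \<omega>)
      show ?case unfolding J_def L_def d_def
        by (rule path_functional_tendsto[OF f B _ \<pi>]) (use elim in auto)
    qed
    show "integrable M (\<lambda>\<omega>. B * C * (\<Prod>t\<in>{r+1..1}. D (\<epsilon> t \<omega>) ^ K))"
      unfolding D_def by (intro integrable_mult_right integrable_\<epsilon>_prod) simp
    show "\<forall>\<^sub>F x in at_top. AE \<omega> in M. norm (J x \<omega> / V.tail x) \<le> B * C * (\<Prod>t\<in>{r+1..1}. D (\<epsilon> t \<omega>) ^ K)"
      using eventually_ge_at_top[of x0]
    proof eventually_elim
      case (elim x)
      have "norm (J x \<omega> / V.tail x) \<le> B * C * (\<Prod>t\<in>{r+1..1}. D (\<epsilon> t \<omega>) ^ K)" for \<omega>
      proof -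
        define w where "w = (\<lambda>t. \<epsilon> t \<omega>)"
        define U where "U = 1 + (cprod r w (nat (- r)) + csum r w (nat (- r))) * (w 1)\<^sup>2"
        have cs: "0 \<le> cprod r w (nat (- r)) + csum r w (nat (- r))"
          by (intro add_nonneg_nonneg cprod_nonneg csum_nonneg)
        have U1: "U \<ge> 1" using cs by (simp add: U_def)
        have D1: "D z \<ge> 1" for z using \<alpha>1_pos \<beta>1_nonneg by (simp add: D_def)
        have facD: "1 + fac z \<le> D z" and sqD: "1 + z\<^sup>2 \<le> D z" for z
          using \<alpha>1_pos \<beta>1_nonneg by (simp_all add: D_def algebra_simps)
        have prod_eq: "(\<Prod>t\<in>{r+1..1}. D (w t)) = (\<Prod>j<nat (- r). D (w (r + 1 + int j))) * D (w 1)"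
        proof -
          have "{r+1..1} = insert 1 ((\<lambda>j. r + 1 + int j) ` {..<nat (- r)})" (is "_ = insert 1 ?S")
          proof (intro equalityI subsetI)
            fix t assume t: "t \<in> {r+1..1}"
            show "t \<in> insert 1 ?S"
            proof (cases "t = 1")
              case False
              with t have "t = r + 1 + int (nat (t - r - 1))" "nat (t - r - 1) < nat (- r)" by auto
              then show ?thesis by blast
            qed simp
          qed (use r in auto)
          moreover have "1 \<notin> ?S" by auto
          moreover have "inj_on (\<lambda>j. r + 1 + int j) {..<nat (- r)}" by (auto simp: inj_on_def)
          ultimately show ?thesis by (simp add: prod.reindex mult.commute)
        qed
        \<comment> \<open>The summand 1 in U is absorbed by p + q >= 1, so that U is bounded by a
          pure product.\<close>
        have "U \<le> (cprod r w (nat (- r)) + csum r w (nat (- r))) * (1 + (w 1)\<^sup>2)"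
          using cprod_csum_bound[of r w "nat (- r)"] by (simp add: U_def distrib_left)
        also have "\<dots> \<le> (\<Prod>j<nat (- r). D (w (r + 1 + int j))) * D (w 1)"
        proof (rule mult_mono)
          have "cprod r w (nat (- r)) + csum r w (nat (- r)) \<le> (\<Prod>j<nat (- r). 1 + fac (w (r + 1 + int j)))"
            using cprod_csum_bound by blast
          also have "\<dots> \<le> (\<Prod>j<nat (- r). D (w (r + 1 + int j)))"
            by (intro prod_mono conjI facD add_nonneg_nonneg fac_nonneg) auto
          finally show "cprod r w (nat (- r)) + csum r w (nat (- r)) \<le> (\<Prod>j<nat (- r). D (w (r + 1 + int j)))" .
          show "0 \<le> (\<Prod>j<nat (- r). D (w (r + 1 + int j)))"
            by (intro prod_nonneg ballI order_trans[OF _ D1]) simp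
        qed (auto intro: sqD)
        finally have UD: "U \<le> (\<Prod>t\<in>{r+1..1}. D (w t))" unfolding prod_eq .
        have "norm (J x \<omega>) \<le> B * V.tail (x / U)"
          using path_functional_bound[OF B, where r=r and I=I and x=x and w=w] by (simp add: J_def w_def U_def)
        also have "\<dots> \<le> B * (C * U ^ K * V.tail x)"
          using B0 elim U1 by (intro mult_left_mono potter) auto
        also have "\<dots> \<le> B * (C * (\<Prod>t\<in>{r+1..1}. D (w t)) ^ K * V.tail x)"
          using B0 C U1 UD by (intro mult_left_mono mult_right_mono power_mono) auto
        finally show ?thesis using V.tail_pos[of x]
          by (simp add: w_def prod_power_distrib divide_simps mult_ac)
      qed
      then show ?case by simp
    qed
    show "(\<lambda>\<omega>. J x \<omega> / V.tail x) \<in> borel_measurable M" for x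
      using J_meas by measurable
    show "L \<in> borel_measurable M"
    proof -
      have [measurable]: "d \<in> borel_measurable M" unfolding d_def by measurable
      have "(\<lambda>\<omega>. \<integral>z. f (\<lambda>t\<in>I. z * sqrt (cprod r (\<lambda>t. \<epsilon> t \<omega>) (nat (t - r))) / d \<omega>) \<partial>\<pi>) \<in> borel_measurable M"
      proof (rule \<pi>.borel_measurable_lebesgue_integral)
        have "(\<lambda>p. f (\<lambda>t\<in>I. snd p * sqrt (cprod r (\<lambda>t. \<epsilon> t (fst p)) (nat (t - r))) / d (fst p)))
            \<in> borel_measurable (M \<Otimes>\<^sub>M \<pi>)"
          by (rule borel_measurable_continuous_restrict[OF f]) measurable
        then show "(\<lambda>(\<omega>, z). f (\<lambda>t\<in>I. z * sqrt (cprod r (\<lambda>t. \<epsilon> t \<omega>) (nat (t - r))) / d \<omega>))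
            \<in> borel_measurable (M \<Otimes>\<^sub>M \<pi>)"
          by (simp add: case_prod_beta')
      qed
      then show ?thesis unfolding L_def[abs_def] by measurable
    qed
  qed
  moreover have "\<forall>\<^sub>F x in at_top. (\<integral>\<omega>. J x \<omega> / V.tail x \<partial>M) =
      (\<integral>\<omega>. f (\<lambda>t\<in>I. \<sigma> t \<omega> / x) * indicator {\<omega> \<in> space M. \<bar>\<zeta> 0 \<omega>\<bar> > x} \<omega> \<partial>M) / V.tail x"
    using eventually_gt_at_top[of 0]
  proof eventually_elim
    case (elim x)
    show ?case unfolding integral_path_functional[OF f B r I elim] J_def[symmetric] by simp
  qed
  ultimately show ?thesis unfolding L_def[symmetric] by (rule Lim_transform_eventually)
qed

end

section \<open>Changes of variables and distribution functions on the line\<close>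

text \<open>The substitution x = y^2 / 2 that links the Gamma density with the modulus of a normal
  variable. It is made on compact intervals, and monotone convergence exhausts the half-line on both
  sides.\<close>

lemma nn_integral_half_square:
  fixes F :: "real \<Rightarrow> ennreal"
  assumes F [measurable]: "F \<in> borel_measurable borel"
  shows "(\<integral>\<^sup>+x. F x * indicator {0..} x \<partial>lborel) =
    (\<integral>\<^sup>+y. F (y\<^sup>2 / 2) * ennreal y * indicator {0..} y \<partial>lborel)"
proof -
  \<comment> \<open>The successor keeps the end points at least 1, so that b <= b^2 and the squared
    end points also exceed every bound.\<close>
  let ?b = "\<lambda>n::nat. real (Suc n)"
  have eq: "(\<integral>\<^sup>+x. F x * indicator {0..(?b n)\<^sup>2 / 2} x \<partial>lborel) =
      (\<integral>\<^sup>+y. F (y\<^sup>2 / 2) * ennreal y * indicator {0..?b n} y \<partial>lborel)" for n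
  proof -
    have "(\<integral>\<^sup>+x. F x * indicator {0\<^sup>2 / 2..(?b n)\<^sup>2 / 2} x \<partial>lborel) =
        (\<integral>\<^sup>+y. F (y\<^sup>2 / 2) * ennreal y * indicator {0..?b n} y \<partial>lborel)"
    proof (rule nn_integral_substitution_aux)
      show "((\<lambda>y. y\<^sup>2 / 2) has_real_derivative y) (at y)" for y :: real
        by (auto intro!: derivative_eq_intros)
    qed (auto intro: continuous_on_id)
    then show ?thesis by simp
  qed
  have unbounded: "eventually (\<lambda>n. x \<le> ?b n) sequentially" "eventually (\<lambda>n. x \<le> (?b n)\<^sup>2 / 2) sequentially" for x
  proof -
    obtain k where k: "x \<le> real k" using real_arch_simple by blast
    show "eventually (\<lambda>n. x \<le> ?b n) sequentially"
      using eventually_ge_at_top[of k] by eventually_elim (use k in auto)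
    show "eventually (\<lambda>n. x \<le> (?b n)\<^sup>2 / 2) sequentially"
      using eventually_ge_at_top[of "2 * k + 1"]
    proof eventually_elim
      case (elim n)
      have "2 * x \<le> ?b n" using k elim by simp
      also have "?b n \<le> (?b n)\<^sup>2" by (simp add: power2_eq_square)
      finally show ?case by simp
    qed
  qed
  have "(\<lambda>n. \<integral>\<^sup>+x. F x * indicator {0..(?b n)\<^sup>2 / 2} x \<partial>lborel)
      \<longlonglongrightarrow> (\<integral>\<^sup>+x. F x * indicator {0..} x \<partial>lborel)"
  proof (rule nn_integral_LIMSEQ)
    show "incseq (\<lambda>n x. F x * indicator {0..(?b n)\<^sup>2 / 2} x)"
    proof (intro incseq_SucI le_funI mult_left_mono)
      fix n x
      have mono: "indicator {0..a} x \<le> (indicator {0..b} x :: ennreal)" if "a \<le> b" for a b :: real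
        using that by (auto split: split_indicator)
      show "indicator {0..(?b n)\<^sup>2 / 2} x \<le> (indicator {0..(?b (Suc n))\<^sup>2 / 2} x :: ennreal)"
        by (intro mono divide_right_mono power_mono) auto
    qed simp
    show "(\<lambda>n. F x * indicator {0..(?b n)\<^sup>2 / 2} x) \<longlonglongrightarrow> F x * indicator {0..} x" for x
      by (rule tendsto_eventually, use unbounded(2)[of x] in eventually_elim) (auto split: split_indicator)
  qed measurable
  moreover have "(\<lambda>n. \<integral>\<^sup>+y. F (y\<^sup>2 / 2) * ennreal y * indicator {0..?b n} y \<partial>lborel)
      \<longlonglongrightarrow> (\<integral>\<^sup>+y. F (y\<^sup>2 / 2) * ennreal y * indicator {0..} y \<partial>lborel)"
  proof (rule nn_integral_LIMSEQ)
    show "incseq (\<lambda>n y. F (y\<^sup>2 / 2) * ennreal y * indicator {0..?b n} y)"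
      by (intro incseq_SucI le_funI mult_left_mono) (auto split: split_indicator)
    show "(\<lambda>n. F (y\<^sup>2 / 2) * ennreal y * indicator {0..?b n} y) \<longlonglongrightarrow> F (y\<^sup>2 / 2) * ennreal y * indicator {0..} y" for y
      by (rule tendsto_eventually, use unbounded(1)[of y] in eventually_elim) (auto split: split_indicator)
  qed measurable
  ultimately show ?thesis unfolding eq by (rule LIMSEQ_unique)
qed

lemma nn_integral_abs_eq_double:
  fixes F :: "real \<Rightarrow> ennreal"
  assumes [measurable]: "F \<in> borel_measurable borel"
  shows "(\<integral>\<^sup>+y. F \<bar>y\<bar> \<partial>lborel) = 2 * (\<integral>\<^sup>+y. F y * indicator {0..} y \<partial>lborel)"
proof -
  have "(\<integral>\<^sup>+y. F \<bar>y\<bar> \<partial>lborel) = (\<integral>\<^sup>+y. F y * indicator {0..} y + F (- y) * indicator {0..} (- y) \<partial>lborel)"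
  proof (rule nn_integral_cong_AE)
    \<comment> \<open>At y = 0 both indicators equal 1 and the identity may fail; this is a null
      set.\<close>
    show "AE y in lborel. F \<bar>y\<bar> = F y * indicator {0..} y + F (- y) * indicator {0..} (- y)"
      using AE_lborel_singleton[of "0::real"] by eventually_elim (auto split: split_indicator)
  qed
  also have "\<dots> = (\<integral>\<^sup>+y. F y * indicator {0..} y \<partial>lborel) + (\<integral>\<^sup>+y. F (- y) * indicator {0..} (- y) \<partial>lborel)"
    by (rule nn_integral_add) measurable
  also have "(\<integral>\<^sup>+y. F (- y) * indicator {0..} (- y) \<partial>lborel) = (\<integral>\<^sup>+y. F y * indicator {0..} y \<partial>lborel)"
    using nn_integral_real_affine[of "\<lambda>y. F y * indicator {0..} y" "-1" 0] by simp
  finally show ?thesis by (simp add: mult_2)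
qed

text \<open>The law of a backward factor is prescribed only inside an open interval. Concentration
  on that interval forces the distribution function to be 0 to its left and 1 to its right.\<close>

lemma real_distribution_eqI_backward_range:
  assumes P: "real_distribution P" and Q: "real_distribution Q" and b: "b \<ge> 0"
    and AE_P: "AE x in P. x \<in> backward_range b" and AE_Q: "AE x in Q. x \<in> backward_range b"
    and eq: "\<And>x. x \<in> backward_range b \<Longrightarrow> cdf P x = cdf Q x"
  shows "P = Q"
proof (rule cdf_unique[OF P Q], rule ext)
  interpret P: real_distribution P by fact
  interpret Q: real_distribution Q by fact
  fix x
  consider "x \<in> backward_range b" | "x \<le> 0" | "b > 0" "x \<ge> b powr (-1/2)"
    using b by (cases "b = 0") (force simp: backward_range_def)+
  then show "cdf P x = cdf Q x"
  proof cases
    case 2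
    have "AE y in P. y \<notin> {..x}" using AE_P
      by eventually_elim (use 2 in \<open>auto simp: backward_range_def split: if_splits\<close>)
    moreover have "AE y in Q. y \<notin> {..x}" using AE_Q
      by eventually_elim (use 2 in \<open>auto simp: backward_range_def split: if_splits\<close>)
    ultimately have "P.prob {..x} = 0" "Q.prob {..x} = 0"
      by (simp_all add: P.prob_eq_0 Q.prob_eq_0 del: atMost_iff)
    then show ?thesis unfolding cdf_def by simp
  next
    case 3
    have "AE y in P. y \<in> {..x}" using AE_P
      by eventually_elim (use 3 in \<open>auto simp: backward_range_def split: if_splits\<close>)
    moreover have "AE y in Q. y \<in> {..x}" using AE_Q
      by eventually_elim (use 3 in \<open>auto simp: backward_range_def split: if_splits\<close>)
    ultimately have "P.prob {..x} = 1" "Q.prob {..x} = 1"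
      by (simp_all add: P.prob_eq_1 Q.prob_eq_1 del: atMost_iff)
    then show ?thesis unfolding cdf_def by simp
  qed (rule eq)
qed

lemma inverse_sqrt_in_backward_range:
  assumes "a > 0" "b \<ge> 0" "y \<noteq> (0::real)"
  shows "1 / sqrt (a * y\<^sup>2 + b) \<in> backward_range b"
proof -
  have pos: "a * y\<^sup>2 > 0" using assms by simp
  show ?thesis
  proof (cases "b = 0")
    case True
    then show ?thesis using pos by (simp add: backward_range_def)
  next
    case False
    then have b: "b > 0" using assms by simp
    then have "b powr (-1/2) = 1 / sqrt b" by (simp add: powr_minus powr_half_sqrt divide_simps flip: powr_half_sqrt)
    moreover have "1 / sqrt (a * y\<^sup>2 + b) < 1 / sqrt b"
      using b pos by (intro divide_strict_left_mono mult_pos_pos) auto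
    ultimately show ?thesis using b pos by (simp add: backward_range_def add_pos_pos)
  qed
qed

section \<open>Laws of single innovations under the weight\<close>

locale garch11_limit = garch11_regvar + T: garch11_tail_process N \<alpha>1 \<beta>1 \<alpha> Z e h A S
  for N :: "'b measure" and Z e :: "'b \<Rightarrow> real" and h A S :: "int \<Rightarrow> 'b \<Rightarrow> real"
begin

lemma nn_integral_\<epsilon>:
  assumes "g \<in> borel_measurable borel"
  shows "(\<integral>\<^sup>+\<omega>. g (\<epsilon> t \<omega>) \<partial>M) = (\<integral>\<^sup>+y. ennreal (std_normal_density y) * g y \<partial>lborel)"
  using distributed_nn_integral[OF \<epsilon>_normal[of t], of g] assms by simp

lemma AE_\<epsilon>_nz: "AE \<omega> in M. \<epsilon> t \<omega> \<noteq> 0"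
  using AE_\<epsilon>_nonzero by eventually_elim blast

lemma fac_powr_expectation:
  shows integrable_fac_powr: "integrable M (\<lambda>\<omega>. fac (\<epsilon> t \<omega>) powr \<alpha>)" (is ?int)
    and expectation_fac_powr: "(\<integral>\<omega>. fac (\<epsilon> t \<omega>) powr \<alpha> \<partial>M) = 1" (is ?exp)
proof -
  \<comment> \<open>A nonintegrable function has Bochner integral 0, so the moment equation with
    value 1 already implies integrability.\<close>
  have "integrable M (\<lambda>\<omega>. fac (\<epsilon> 0 \<omega>) powr \<alpha>)"
    using \<alpha>_eq not_integrable_integral_eq by fastforce
  then have "integrable lborel (\<lambda>y. std_normal_density y * fac y powr \<alpha>)"
    by (subst distributed_integrable[OF \<epsilon>_normal[of 0]]) auto
  then show ?int by (subst (asm) distributed_integrable[OF \<epsilon>_normal[of t]]) auto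
  have "(\<integral>\<omega>. fac (\<epsilon> t \<omega>) powr \<alpha> \<partial>M) = (\<integral>y. std_normal_density y * fac y powr \<alpha> \<partial>lborel)"
    by (subst distributed_integral[OF \<epsilon>_normal[of t]]) auto
  also have "\<dots> = (\<integral>\<omega>. fac (\<epsilon> 0 \<omega>) powr \<alpha> \<partial>M)"
    by (subst distributed_integral[OF \<epsilon>_normal[of 0]]) auto
  finally show ?exp using \<alpha>_eq by simp
qed

lemma nn_integral_fac_powr: "(\<integral>\<^sup>+\<omega>. ennreal (fac (\<epsilon> t \<omega>) powr \<alpha>) \<partial>M) = 1"
  by (subst nn_integral_eq_integral[OF integrable_fac_powr]) (simp_all add: expectation_fac_powr)

lemma e_measurable [measurable]: "e \<in> borel_measurable N"
  and Z_measurable [measurable]: "Z \<in> borel_measurable N"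
  using T.indep_var_rv2[OF T.Z_e_indep] T.indep_var_rv1[OF T.Z_e_indep] by auto

lemma h_measurable: "t \<ge> 2 \<Longrightarrow> h t \<in> borel_measurable N"
  using T.h_indep by (auto simp: T.indep_vars_def)

lemma A_measurable: "t \<le> -1 \<or> t \<ge> 2 \<Longrightarrow> A t \<in> borel_measurable N"
proof (cases "t \<ge> 2")
  case True
  note [measurable] = h_measurable[OF True]
  show ?thesis by (subst measurable_cong[OF T.A_forward[OF True]]) measurable
qed (use T.A_backward_indep in \<open>auto simp: T.indep_vars_def\<close>)

lemma S_01_measurable [measurable]: "S 0 \<in> borel_measurable N" "S 1 \<in> borel_measurable N"
proof -
  show [measurable]: "S 0 \<in> borel_measurable N"
    by (subst measurable_cong[OF T.S_0]) measurable
  show "S 1 \<in> borel_measurable N"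
    by (subst measurable_cong[OF T.S_1]) measurable
qed

text \<open>By the moment equation \<open>fac (\<epsilon> t \<omega>) powr \<alpha>\<close> is a
  probability density. The reciprocal factor is at most x exactly when |epsilon_t| >= k, and folding
  the symmetric normal density onto the half-line gives the prefactor 2 / sqrt(2 pi) = sqrt(2 / pi).
  The index drops by one because epsilon_t leads from time t - 1 to t, and the backward step to time
  t - 1 undoes it.\<close>

lemma distr_backward_factor:
  assumes t: "t \<le> 0"
  shows "distr (density M (\<lambda>\<omega>. ennreal (fac (\<epsilon> t \<omega>) powr \<alpha>))) borel (\<lambda>\<omega>. 1 / sqrt (fac (\<epsilon> t \<omega>)))
    = distr N borel (A (t - 1))"
proof (rule real_distribution_eqI_backward_range[OF _ _ \<beta>1_nonneg])
  let ?D = "density M (\<lambda>\<omega>. ennreal (fac (\<epsilon> t \<omega>) powr \<alpha>))"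
  have [measurable]: "A (t - 1) \<in> borel_measurable N" using t by (intro A_measurable) simp
  interpret D: prob_space ?D
    by (rule prob_spaceI) (simp add: emeasure_density nn_integral_fac_powr cong: nn_integral_cong)
  show "real_distribution (distr ?D borel (\<lambda>\<omega>. 1 / sqrt (fac (\<epsilon> t \<omega>))))"
    by (rule D.real_distribution_distr) simp
  show "real_distribution (distr N borel (A (t - 1)))"
    by (rule T.real_distribution_distr) simp
  have range_sets [measurable]: "backward_range \<beta>1 \<in> sets borel"
    by (simp add: backward_range_def)
  show "AE x in distr N borel (A (t - 1)). x \<in> backward_range \<beta>1"
    using T.A_backward_range[of "t - 1"] t by (subst AE_distr_iff) auto
  show "AE x in distr ?D borel (\<lambda>\<omega>. 1 / sqrt (fac (\<epsilon> t \<omega>))). x \<in> backward_range \<beta>1"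
  proof (subst AE_distr_iff)
    show "AE \<omega> in ?D. 1 / sqrt (fac (\<epsilon> t \<omega>)) \<in> backward_range \<beta>1"
      using AE_\<epsilon>_nz[of t] inverse_sqrt_in_backward_range[OF \<alpha>1_pos \<beta>1_nonneg]
      by (subst AE_density) (auto elim!: eventually_mono)
  qed auto
  fix x assume x: "x \<in> backward_range \<beta>1"
  define k where "k = sqrt ((1 / x\<^sup>2 - \<beta>1) / \<alpha>1)"
  define G where "G y = ennreal (std_normal_density y * fac y powr \<alpha>) * indicator {k..} y" for y
  have [measurable]: "G \<in> borel_measurable borel" unfolding G_def by measurable
  have x0: "x > 0" using x by (auto simp: backward_range_def split: if_splits)
  have "\<beta>1 < 1 / x\<^sup>2"
  proof (cases "\<beta>1 = 0")
    case False
    then have b: "\<beta>1 > 0" using \<beta>1_nonneg by simp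
    then have "x < 1 / sqrt \<beta>1"
      using x False by (simp add: backward_range_def powr_minus divide_simps flip: powr_half_sqrt)
    then have "x\<^sup>2 < (1 / sqrt \<beta>1)\<^sup>2" using x0 by (intro power_strict_mono) auto
    also have "\<dots> = 1 / \<beta>1" using b by (simp add: power_divide)
    finally show ?thesis using x0 b by (simp add: field_simps)
  qed (use x0 in simp)
  \<comment> \<open>Positivity makes {k..} a subset of the half-line produced by the folding, so one
    indicator remains.\<close>
  then have k0: "k > 0" unfolding k_def using \<alpha>1_pos by simp
  have iff: "1 / sqrt (fac y) \<le> x \<longleftrightarrow> k \<le> \<bar>y\<bar>" if "y \<noteq> 0" for y
  proof -
    have f: "fac y > 0" using that by (rule fac_pos)
    have "1 / sqrt (fac y) \<le> x \<longleftrightarrow> 1 / x \<le> sqrt (fac y)"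
      using f x0 by (simp add: field_simps)
    also have "\<dots> \<longleftrightarrow> 1 / x\<^sup>2 \<le> fac y"
      using x0 f by (simp add: real_le_rsqrt real_le_lsqrt power_divide real_sqrt_le_iff[symmetric, of "1 / x\<^sup>2"] real_sqrt_divide del: real_sqrt_le_iff)
    also have "\<dots> \<longleftrightarrow> (1 / x\<^sup>2 - \<beta>1) / \<alpha>1 \<le> y\<^sup>2"
      using \<alpha>1_pos by (simp add: field_simps)
    also have "\<dots> \<longleftrightarrow> k \<le> \<bar>y\<bar>" unfolding k_def real_sqrt_abs[symmetric] real_sqrt_le_iff ..
    finally show ?thesis .
  qed
  have "emeasure (distr ?D borel (\<lambda>\<omega>. 1 / sqrt (fac (\<epsilon> t \<omega>)))) {..x}
      = (\<integral>\<^sup>+\<omega>. ennreal (fac (\<epsilon> t \<omega>) powr \<alpha>) * indicator {..x} (1 / sqrt (fac (\<epsilon> t \<omega>))) \<partial>M)"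
    by (subst emeasure_distr) (auto simp: emeasure_density intro!: nn_integral_cong split: split_indicator)
  also have "\<dots> = (\<integral>\<^sup>+y. ennreal (std_normal_density y) * (ennreal (fac y powr \<alpha>) * indicator {..x} (1 / sqrt (fac y))) \<partial>lborel)"
    by (rule nn_integral_\<epsilon>) measurable
  also have "\<dots> = (\<integral>\<^sup>+y. G \<bar>y\<bar> \<partial>lborel)"
  proof (rule nn_integral_cong_AE)
    show "AE y in lborel. ennreal (std_normal_density y) * (ennreal (fac y powr \<alpha>) * indicator {..x} (1 / sqrt (fac y))) = G \<bar>y\<bar>"
      using AE_lborel_singleton[of "0::real"]
    proof eventually_elim
      case (elim y)
      have "std_normal_density \<bar>y\<bar> = std_normal_density y" by (simp add: std_normal_density_def)
      then show ?case
        using iff[OF elim] by (simp add: G_def ennreal_mult' mult.assoc indicator_def)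
    qed
  qed
  also have "\<dots> = 2 * (\<integral>\<^sup>+y. G y * indicator {0..} y \<partial>lborel)"
    by (rule nn_integral_abs_eq_double) measurable
  also have "(\<integral>\<^sup>+y. G y * indicator {0..} y \<partial>lborel) =
      (\<integral>\<^sup>+y. ennreal (indicator {k..} y * (std_normal_density y * fac y powr \<alpha>)) \<partial>lborel)"
    using k0 by (intro nn_integral_cong) (auto simp: G_def split: split_indicator)
  also have "\<dots> = ennreal (\<integral>y. indicator {k..} y * (std_normal_density y * fac y powr \<alpha>) \<partial>lborel)"
  proof (rule nn_integral_eq_integral)
    have "integrable lborel (\<lambda>y. std_normal_density y * fac y powr \<alpha>)"
      by (subst distributed_integrable[OF \<epsilon>_normal[of t]]) (use integrable_fac_powr[of t] in auto)
    then show "integrable lborel (\<lambda>y. indicator {k..} y * (std_normal_density y * fac y powr \<alpha>))"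
      using integrable_mult_indicator[of "{k..}" lborel "\<lambda>y. std_normal_density y * fac y powr \<alpha>"] by simp
  qed auto
  also have "(\<integral>y. indicator {k..} y * (std_normal_density y * fac y powr \<alpha>) \<partial>lborel) =
      (\<integral>y. 1 / sqrt (2 * pi) * (indicator {k..} y * (fac y powr \<alpha> * exp (- (1/2) * y\<^sup>2))) \<partial>lborel)"
    by (intro Bochner_Integration.integral_cong) (auto simp: std_normal_density_def)
  also have "\<dots> = 1 / sqrt (2 * pi) * (LBINT y:{k..}. fac y powr \<alpha> * exp (- (1/2) * y\<^sup>2))"
    by (subst integral_mult_right_zero) (simp add: set_lebesgue_integral_def)
  also have "2 * ennreal (1 / sqrt (2 * pi) * (LBINT y:{k..}. fac y powr \<alpha> * exp (- (1/2) * y\<^sup>2))) =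
      ennreal (sqrt (2 / pi) * (LBINT y:{k..}. fac y powr \<alpha> * exp (- (1/2) * y\<^sup>2)))"
  proof -
    have "2 * (1 / sqrt (2 * pi)) = sqrt (2 / pi)"
      by (simp add: real_sqrt_mult real_sqrt_divide field_simps)
    moreover have "2 * ennreal u = ennreal (2 * u)" for u by (simp add: ennreal_mult')
    ultimately show ?thesis by (simp only: mult.assoc[symmetric])
  qed
  also have "sqrt (2 / pi) * (LBINT y:{k..}. fac y powr \<alpha> * exp (- (1/2) * y\<^sup>2)) =
      T.prob {\<omega> \<in> space N. A (t - 1) \<omega> \<le> x}"
    using T.A_backward_cdf[of "t - 1" x] t x by (simp add: k_def)
  finally have "emeasure (distr ?D borel (\<lambda>\<omega>. 1 / sqrt (fac (\<epsilon> t \<omega>)))) {..x} = ennreal (T.prob {\<omega> \<in> space N. A (t - 1) \<omega> \<le> x})" .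
  moreover have "cdf (distr N borel (A (t - 1))) x = T.prob {\<omega> \<in> space N. A (t - 1) \<omega> \<le> x}"
    unfolding cdf_def by (subst measure_distr) (auto intro!: arg_cong[where f=T.prob])
  ultimately show "cdf (distr ?D borel (\<lambda>\<omega>. 1 / sqrt (fac (\<epsilon> t \<omega>)))) x = cdf (distr N borel (A (t - 1))) x"
    by (simp add: cdf_def measure_def)
qed

text \<open>The absolute moment of order 2 alpha of a standard normal variable, hence the total mass
  of the weight d^(2 alpha).\<close>

definition tilt_const :: real where
  "tilt_const = 2 powr \<alpha> * Gamma (\<alpha> + 1/2) / sqrt pi"

lemma tilt_const_pos: "tilt_const > 0"
  unfolding tilt_const_def using \<alpha>_pos by (intro divide_pos_pos mult_pos_pos Gamma_real_pos) auto

text \<open>Multiplying the normal density by |y|^(2 alpha) and substituting x = y^2 / 2 yields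
  x^(alpha - 1/2) exp(-x) up to a constant, the Gamma density of shape alpha + 1/2. The test
  function sees only the modulus, which is all that \<open>S 0\<close> and \<open>S 1\<close> take
  from \<open>e\<close>.\<close>

lemma nn_integral_tilted_\<epsilon>:
  assumes [measurable]: "\<psi> \<in> borel_measurable borel"
  shows "(\<integral>\<^sup>+\<omega>. ennreal (\<bar>\<epsilon> t \<omega>\<bar> powr (2 * \<alpha>)) * \<psi> \<bar>\<epsilon> t \<omega>\<bar> \<partial>M) = ennreal tilt_const * (\<integral>\<^sup>+\<omega>. \<psi> \<bar>e \<omega>\<bar> \<partial>N)"
proof -
  define H where "H y = ennreal (std_normal_density y * y powr (2 * \<alpha>)) * \<psi> y" for y
  have [measurable]: "H \<in> borel_measurable borel" unfolding H_def by measurable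
  let ?\<gamma> = "gamma_density (\<alpha> + 1/2)"
  have [measurable]: "?\<gamma> \<in> borel_measurable borel" unfolding gamma_density_def[abs_def] by measurable
  \<comment> \<open>The density identity behind the change of measure: the factor y on the left is
    the Jacobian of y^2 / 2, the 2 on the right comes from folding the line.\<close>
  have key: "tilt_const * (?\<gamma> (y\<^sup>2 / 2) * y) = 2 * (std_normal_density y * y powr (2 * \<alpha>))" if "y > 0" for y
  proof -
    have G: "Gamma (\<alpha> + 1/2) > 0" using \<alpha>_pos by (intro Gamma_real_pos) simp
    have "(y\<^sup>2 / 2) powr (\<alpha> + 1/2 - 1) = (y powr 2) powr (\<alpha> - 1/2) / 2 powr (\<alpha> - 1/2)"
      using that by (simp add: powr_divide powr_realpow)
    also have "(y powr 2) powr (\<alpha> - 1/2) = y powr (2 * \<alpha> - 1)"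
      by (simp add: powr_powr algebra_simps)
    also have "y powr (2 * \<alpha> - 1) = y powr (2 * \<alpha>) / y" using that by (simp add: powr_diff)
    also have "2 powr (\<alpha> - 1/2) = 2 powr \<alpha> / sqrt 2" by (simp add: powr_diff powr_half_sqrt)
    finally have p: "(y\<^sup>2 / 2) powr (\<alpha> + 1/2 - 1) = y powr (2 * \<alpha>) * sqrt 2 / (y * 2 powr \<alpha>)" by simp
    have "tilt_const * (?\<gamma> (y\<^sup>2 / 2) * y) = sqrt 2 / sqrt pi * exp (- (y\<^sup>2 / 2)) * y powr (2 * \<alpha>)"
      unfolding gamma_density_def tilt_const_def p using that G by (simp add: field_simps)
    also have "sqrt 2 / sqrt pi = 2 * (1 / sqrt (2 * pi))" by (simp add: real_sqrt_mult field_simps)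
    finally show ?thesis by (simp add: std_normal_density_def)
  qed
  have "(\<integral>\<^sup>+\<omega>. ennreal (\<bar>\<epsilon> t \<omega>\<bar> powr (2 * \<alpha>)) * \<psi> \<bar>\<epsilon> t \<omega>\<bar> \<partial>M) =
      (\<integral>\<^sup>+y. ennreal (std_normal_density y) * (ennreal (\<bar>y\<bar> powr (2 * \<alpha>)) * \<psi> \<bar>y\<bar>) \<partial>lborel)"
    by (rule nn_integral_\<epsilon>) measurable
  also have "\<dots> = (\<integral>\<^sup>+y. H \<bar>y\<bar> \<partial>lborel)"
  proof (rule nn_integral_cong)
    fix y :: real
    have "std_normal_density \<bar>y\<bar> = std_normal_density y" by (simp add: std_normal_density_def)
    then show "ennreal (std_normal_density y) * (ennreal (\<bar>y\<bar> powr (2 * \<alpha>)) * \<psi> \<bar>y\<bar>) = H \<bar>y\<bar>"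
      by (simp add: H_def ennreal_mult' mult.assoc)
  qed
  also have "\<dots> = 2 * (\<integral>\<^sup>+y. H y * indicator {0..} y \<partial>lborel)"
    by (rule nn_integral_abs_eq_double) measurable
  also have "\<dots> = (\<integral>\<^sup>+y. 2 * (H y * indicator {0..} y) \<partial>lborel)"
    by (rule nn_integral_cmult[symmetric]) measurable
  \<comment> \<open>Writing y as the root of 2 (y^2 / 2) exhibits the integrand as a function of y^2
    / 2 times the Jacobian.\<close>
  also have "\<dots> = (\<integral>\<^sup>+y. ennreal tilt_const * (ennreal (?\<gamma> (y\<^sup>2 / 2)) * \<psi> (sqrt (2 * (y\<^sup>2 / 2))) * ennreal y * indicator {0..} y) \<partial>lborel)"
  proof (rule nn_integral_cong_AE)
    show "AE y in lborel. 2 * (H y * indicator {0..} y) =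
        ennreal tilt_const * (ennreal (?\<gamma> (y\<^sup>2 / 2)) * \<psi> (sqrt (2 * (y\<^sup>2 / 2))) * ennreal y * indicator {0..} y)"
      using AE_lborel_singleton[of "0::real"]
    proof eventually_elim
      case (elim y)
      show ?case
      proof (cases "y > 0")
        case True
        have g0: "?\<gamma> (y\<^sup>2 / 2) \<ge> 0"
          using \<alpha>_pos by (auto simp: gamma_density_def intro!: divide_nonneg_pos Gamma_real_pos)
        have "2 * H y = ennreal (2 * (std_normal_density y * y powr (2 * \<alpha>))) * \<psi> y"
          by (simp add: H_def ennreal_mult' mult.assoc)
        also have "\<dots> = ennreal (tilt_const * (?\<gamma> (y\<^sup>2 / 2) * y)) * \<psi> y" by (simp only: key[OF True])
        also have "\<dots> = ennreal tilt_const * (ennreal (?\<gamma> (y\<^sup>2 / 2)) * \<psi> y * ennreal y)"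
          using True g0 tilt_const_pos by (simp add: ennreal_mult' mult_ac)
        finally show ?thesis using True by simp
      qed (use elim in simp)
    qed
  qed
  also have "\<dots> = ennreal tilt_const * (\<integral>\<^sup>+y. ennreal (?\<gamma> (y\<^sup>2 / 2)) * \<psi> (sqrt (2 * (y\<^sup>2 / 2))) * ennreal y * indicator {0..} y \<partial>lborel)"
    by (rule nn_integral_cmult) measurable
  also have "(\<integral>\<^sup>+y. ennreal (?\<gamma> (y\<^sup>2 / 2)) * \<psi> (sqrt (2 * (y\<^sup>2 / 2))) * ennreal y * indicator {0..} y \<partial>lborel) =
     (\<integral>\<^sup>+x. ennreal (?\<gamma> x) * \<psi> (sqrt (2 * x)) * indicator {0..} x \<partial>lborel)"
    by (rule nn_integral_half_square[symmetric]) measurable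
  also have "\<dots> = (\<integral>\<^sup>+x. ennreal (?\<gamma> x) * \<psi> (sqrt (2 * x)) \<partial>lborel)"
    by (intro nn_integral_cong) (auto simp: gamma_density_def split: split_indicator)
  also have "\<dots> = (\<integral>\<^sup>+\<omega>. \<psi> (sqrt (2 * ((e \<omega>)\<^sup>2 / 2))) \<partial>N)"
    by (rule distributed_nn_integral[OF T.e_gamma]) measurable
  finally show ?thesis by simp
qed

text \<open>Innovations after time 1 do not enter d, so their factors carry no weight and keep the
  normal law.\<close>

lemma nn_integral_forward_factor:
  assumes t: "t \<ge> 2" and [measurable]: "g \<in> borel_measurable borel"
  shows "(\<integral>\<^sup>+\<omega>. g (sqrt (fac (\<epsilon> t \<omega>))) \<partial>M) = (\<integral>\<^sup>+\<omega>. g (A t \<omega>) \<partial>N)"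
proof -
  have "(\<integral>\<^sup>+\<omega>. g (sqrt (fac (\<epsilon> t \<omega>))) \<partial>M) = (\<integral>\<^sup>+y. ennreal (std_normal_density y) * g (sqrt (fac y)) \<partial>lborel)"
    by (rule nn_integral_\<epsilon>) measurable
  also have "\<dots> = (\<integral>\<^sup>+\<omega>. g (sqrt (fac (h t \<omega>))) \<partial>N)"
    by (rule distributed_nn_integral[OF T.h_normal[OF t]]) measurable
  also have "\<dots> = (\<integral>\<^sup>+\<omega>. g (A t \<omega>) \<partial>N)"
    using T.A_forward[OF t] by (intro nn_integral_cong) simp
  finally show ?thesis .
qed

lemma nn_integral_backward_factor:
  assumes t: "t \<le> 0" and [measurable]: "g \<in> borel_measurable borel"
  shows "(\<integral>\<^sup>+\<omega>. ennreal (fac (\<epsilon> t \<omega>) powr \<alpha>) * g (1 / sqrt (fac (\<epsilon> t \<omega>))) \<partial>M) = (\<integral>\<^sup>+\<omega>. g (A (t - 1) \<omega>) \<partial>N)"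
proof -
  have [measurable]: "A (t - 1) \<in> borel_measurable N" using t by (intro A_measurable) simp
  have "(\<integral>\<^sup>+\<omega>. ennreal (fac (\<epsilon> t \<omega>) powr \<alpha>) * g (1 / sqrt (fac (\<epsilon> t \<omega>))) \<partial>M) =
      (\<integral>\<^sup>+x. g x \<partial>distr (density M (\<lambda>\<omega>. ennreal (fac (\<epsilon> t \<omega>) powr \<alpha>))) borel (\<lambda>\<omega>. 1 / sqrt (fac (\<epsilon> t \<omega>))))"
    by (simp add: nn_integral_distr nn_integral_density)
  also have "\<dots> = (\<integral>\<^sup>+\<omega>. g (A (t - 1) \<omega>) \<partial>N)"
    unfolding distr_backward_factor[OF t] by (rule nn_integral_distr) auto
  finally show ?thesis .
qed

end

section \<open>Frames and their joint laws\<close>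

lemma (in prob_space) indep_vars_prob_Ball:
  assumes X: "indep_vars (\<lambda>_. borel) X I" and J: "finite J" "J \<subseteq> I"
    and B: "\<And>t. t \<in> J \<Longrightarrow> B t \<in> sets borel"
  shows "prob {\<omega> \<in> space M. \<forall>t\<in>J. X t \<omega> \<in> B t} = (\<Prod>t\<in>J. prob {\<omega> \<in> space M. X t \<omega> \<in> B t})"
proof (cases "J = {}")
  case True
  then show ?thesis by (simp add: prob_space)
next
  case False
  have inter: "{\<omega> \<in> space M. \<forall>t\<in>J. X t \<omega> \<in> B t} = (\<Inter>t\<in>J. X t -` B t \<inter> space M)"
    using False by auto
  have vimage: "{\<omega> \<in> space M. X t \<omega> \<in> B t} = X t -` B t \<inter> space M" for t by auto
  show ?thesis unfolding inter vimage by (rule indep_varsD[OF X False J B])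
qed

lemma (in prob_space) indep_var_prob_conj:
  assumes XY: "indep_var (PiM I (\<lambda>_. borel)) (\<lambda>\<omega>. \<lambda>t\<in>I. X t \<omega>) (PiM J (\<lambda>_. borel)) (\<lambda>\<omega>. \<lambda>t\<in>J. Y t \<omega>)"
    and fin: "finite I'" "I' \<subseteq> I" "finite J'" "J' \<subseteq> J"
    and B: "\<And>t. t \<in> I' \<union> J' \<Longrightarrow> B t \<in> sets borel"
  shows "prob {\<omega> \<in> space M. (\<forall>t\<in>I'. X t \<omega> \<in> B t) \<and> (\<forall>t\<in>J'. Y t \<omega> \<in> B t)} =
    prob {\<omega> \<in> space M. \<forall>t\<in>I'. X t \<omega> \<in> B t} * prob {\<omega> \<in> space M. \<forall>t\<in>J'. Y t \<omega> \<in> B t}"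
proof -
  define P where "P = {w \<in> space (PiM I (\<lambda>_. borel)). \<forall>t\<in>I'. w t \<in> B t}"
  define Q where "Q = {w \<in> space (PiM J (\<lambda>_. borel)). \<forall>t\<in>J'. w t \<in> B t}"
  have P: "P \<in> sets (PiM I (\<lambda>_. borel))" unfolding P_def
    using fin B by (intro sets.sets_Collect_finite_All measurable_sets_Collect[OF measurable_component_singleton])
      (auto simp: subset_iff)
  have Q: "Q \<in> sets (PiM J (\<lambda>_. borel))" unfolding Q_def
    using fin B by (intro sets.sets_Collect_finite_All measurable_sets_Collect[OF measurable_component_singleton])
      (auto simp: subset_iff)
  have Pset: "(\<lambda>\<omega>. \<lambda>t\<in>I. X t \<omega>) -` P \<inter> space M = {\<omega> \<in> space M. \<forall>t\<in>I'. X t \<omega> \<in> B t}"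
    using fin by (auto simp: P_def space_PiM subset_iff)
  have Qset: "(\<lambda>\<omega>. \<lambda>t\<in>J. Y t \<omega>) -` Q \<inter> space M = {\<omega> \<in> space M. \<forall>t\<in>J'. Y t \<omega> \<in> B t}"
    using fin by (auto simp: Q_def space_PiM subset_iff)
  have "(\<lambda>\<omega>. (\<lambda>t\<in>I. X t \<omega>, \<lambda>t\<in>J. Y t \<omega>)) -` (P \<times> Q) \<inter> space M =
      {\<omega> \<in> space M. (\<forall>t\<in>I'. X t \<omega> \<in> B t) \<and> (\<forall>t\<in>J'. Y t \<omega> \<in> B t)}"
    using Pset Qset by auto
  then show ?thesis using indep_varD[OF XY P Q] unfolding Pset Qset by simp
qed

context garch11_limit
begin

definition pareto_law :: "real measure" where
  "pareto_law = distr N borel Z"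

lemma sets_pareto_law [measurable_cong, simp]: "sets pareto_law = sets borel"
  by (simp add: pareto_law_def)

lemma real_distribution_pareto_law: "real_distribution pareto_law"
  unfolding pareto_law_def by (rule T.real_distribution_distr) simp

lemma pareto_law_tail: "x \<ge> 1 \<Longrightarrow> measure pareto_law {x<..} = x powr (- (2 * \<alpha>))"
  unfolding pareto_law_def using T.Z_tail[of x]
  by (subst measure_distr) (auto simp: vimage_def Int_def conj_commute)

text \<open>
  The processes are compared through frames, whose coordinates are the factors \<open>A t\<close> for
  \<open>t \<notin> {0, 1}\<close> and \<open>S 0\<close>, \<open>S 1\<close>; the frame of the limit process has independent blocks.
\<close>

definition limit_frame :: "'b \<Rightarrow> int \<Rightarrow> real" where
  "limit_frame \<omega> t = (if t = 0 \<or> t = 1 then S t \<omega> else A t \<omega>)"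

text \<open>The candidate frame built from a Pareto value z and the innovations. Coordinate t < 0
  inverts the factor of epsilon_{t+1}, which leads from time t to t + 1; coordinates 0 and 1 share
  both z and epsilon_1.\<close>

definition noise_frame :: "'a \<Rightarrow> real \<Rightarrow> int \<Rightarrow> real" where
  "noise_frame \<omega> z t =
     (if t \<ge> 2 then sqrt (fac (\<epsilon> t \<omega>))
      else if t = 1 then z / \<bar>\<epsilon> 1 \<omega>\<bar> * sqrt (fac (\<epsilon> 1 \<omega>))
      else if t = 0 then z / \<bar>\<epsilon> 1 \<omega>\<bar>
      else 1 / sqrt (fac (\<epsilon> (t + 1) \<omega>)))"

definition tilt :: "int \<Rightarrow> 'a \<Rightarrow> real" where
  "tilt r \<omega> = (sqrt (cprod r (\<lambda>t. \<epsilon> t \<omega>) (nat (- r))) * \<bar>\<epsilon> 1 \<omega>\<bar>) powr (2 * \<alpha>)"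

text \<open>Coordinates 0 and 1 of a frame are dependent. Integrating out z turns the condition on
  both into one function of |epsilon_1|, so that the whole integrand is a product over innovations;
  \<open>fac\<close> is even, which permits the modulus y in its argument.\<close>

definition start_mass :: "real set \<Rightarrow> real set \<Rightarrow> real \<Rightarrow> ennreal" where
  "start_mass B0 B1 y =
     (\<integral>\<^sup>+z. indicator B0 (z / y) * indicator B1 (z / y * sqrt (fac y)) \<partial>pareto_law)"

lemma limit_frame_measurable [measurable]: "(\<lambda>\<omega>. limit_frame \<omega> t) \<in> borel_measurable N"
proof (cases "t = 0 \<or> t = 1")
  case False
  then have "A t \<in> borel_measurable N" by (intro A_measurable) auto
  then show ?thesis using False by (simp add: limit_frame_def)
qed (auto simp: limit_frame_def)

lemma noise_frame_measurable [measurable]: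
  "(\<lambda>p. noise_frame (fst p) (snd p) t) \<in> borel_measurable (M \<Otimes>\<^sub>M pareto_law)"
  unfolding noise_frame_def by measurable

lemma cprod_eq_prod: "cprod r w (nat (t - r)) = (\<Prod>j\<in>{r+1..t}. fac (w j))"
proof -
  have "{r+1..t} = (\<lambda>j. r + 1 + int j) ` {..<nat (t - r)}"
  proof (intro equalityI subsetI)
    fix i assume i: "i \<in> {r+1..t}"
    then have "i = r + 1 + int (nat (i - r - 1))" "nat (i - r - 1) < nat (t - r)" by auto
    then show "i \<in> (\<lambda>j. r + 1 + int j) ` {..<nat (t - r)}" by blast
  qed auto
  moreover have "inj_on (\<lambda>j. r + 1 + int j) {..<nat (t - r)}" by (auto simp: inj_on_def)
  ultimately show ?thesis by (simp add: cprod_def prod.reindex)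
qed

lemma tilt_eq: "tilt r \<omega> = (\<Prod>j\<in>{r+1..0}. fac (\<epsilon> j \<omega>) powr \<alpha>) * \<bar>\<epsilon> 1 \<omega>\<bar> powr (2 * \<alpha>)"
proof -
  have "sqrt x powr (2 * \<alpha>) = x powr \<alpha>" if "x \<ge> 0" for x
    using that by (simp add: powr_powr flip: powr_half_sqrt)
  then have "tilt r \<omega> = cprod r (\<lambda>t. \<epsilon> t \<omega>) (nat (0 - r)) powr \<alpha> * \<bar>\<epsilon> 1 \<omega>\<bar> powr (2 * \<alpha>)"
    by (simp add: tilt_def powr_mult cprod_nonneg)
  also have "cprod r (\<lambda>t. \<epsilon> t \<omega>) (nat (0 - r)) powr \<alpha> = (\<Prod>j\<in>{r+1..0}. fac (\<epsilon> j \<omega>) powr \<alpha>)"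
    unfolding cprod_eq_prod by (rule prod_powr_distrib)
  finally show ?thesis .
qed

lemma tilt_measurable [measurable]: "tilt r \<in> borel_measurable M"
  unfolding tilt_eq[abs_def] by measurable

lemma start_mass_measurable [measurable]:
  assumes [measurable]: "B0 \<in> sets borel" "B1 \<in> sets borel"
  shows "start_mass B0 B1 \<in> borel_measurable borel"
proof -
  interpret P: real_distribution pareto_law by (rule real_distribution_pareto_law)
  show ?thesis unfolding start_mass_def[abs_def] by measurable
qed

lemma start_mass_eq_prob:
  assumes [measurable]: "B0 \<in> sets borel" "B1 \<in> sets borel"
  shows "(\<integral>\<^sup>+\<omega>. start_mass B0 B1 \<bar>e \<omega>\<bar> \<partial>N) = ennreal (T.prob {\<omega> \<in> space N. S 0 \<omega> \<in> B0 \<and> S 1 \<omega> \<in> B1})"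
proof -
  interpret P: real_distribution pareto_law by (rule real_distribution_pareto_law)
  interpret E: prob_space "distr N borel e" by (rule T.prob_space_distr) simp
  interpret ZE: pair_prob_space pareto_law "distr N borel e" ..
  let ?g = "\<lambda>p. indicator B0 (fst p / \<bar>snd p\<bar>) * indicator B1 (fst p / \<bar>snd p\<bar> * sqrt (fac (snd p))) :: ennreal"
  have joint: "distr N (borel \<Otimes>\<^sub>M borel) (\<lambda>\<omega>. (Z \<omega>, e \<omega>)) = pareto_law \<Otimes>\<^sub>M distr N borel e"
    using T.Z_e_indep by (simp add: T.indep_var_distribution_eq pareto_law_def)
  have gm: "?g \<in> borel_measurable (borel \<Otimes>\<^sub>M borel)" by measurable
  have "(\<integral>\<^sup>+\<omega>. start_mass B0 B1 \<bar>e \<omega>\<bar> \<partial>N) = (\<integral>\<^sup>+y. start_mass B0 B1 \<bar>y\<bar> \<partial>distr N borel e)"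
    by (subst nn_integral_distr) auto
  also have "\<dots> = (\<integral>\<^sup>+y. \<integral>\<^sup>+z. ?g (z, y) \<partial>pareto_law \<partial>distr N borel e)"
    by (simp add: start_mass_def)
  also have "\<dots> = (\<integral>\<^sup>+p. ?g p \<partial>(pareto_law \<Otimes>\<^sub>M distr N borel e))"
    by (rule ZE.nn_integral_snd) (use gm in simp)
  also have "\<dots> = (\<integral>\<^sup>+\<omega>. ?g (Z \<omega>, e \<omega>) \<partial>N)"
    unfolding joint[symmetric] by (rule nn_integral_distr) (use gm in auto)
  also have "\<dots> = (\<integral>\<^sup>+\<omega>. indicator {\<omega> \<in> space N. S 0 \<omega> \<in> B0 \<and> S 1 \<omega> \<in> B1} \<omega> \<partial>N)"
    by (rule nn_integral_cong) (auto simp: T.S_0 T.S_1 split: split_indicator)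
  also have "\<dots> = ennreal (T.prob {\<omega> \<in> space N. S 0 \<omega> \<in> B0 \<and> S 1 \<omega> \<in> B1})"
    by (subst nn_integral_indicator) (auto simp: T.emeasure_eq_measure)
  finally show ?thesis .
qed

text \<open>Independence is peeled off in two layers: the backward factors from all the rest, then
  the forward innovations from the pair at times 0 and 1. The pair itself stays a single
  block.\<close>

lemma limit_frame_box:
  assumes r: "r \<le> 0" and n: "n \<ge> 1" and B: "\<And>t. t \<in> {r..n} \<Longrightarrow> B t \<in> sets borel"
  shows "T.prob {\<omega> \<in> space N. \<forall>t\<in>{r..n}. limit_frame \<omega> t \<in> B t} =
    (\<Prod>t\<in>{r..-1}. T.prob {\<omega> \<in> space N. A t \<omega> \<in> B t}) *
    (T.prob {\<omega> \<in> space N. S 0 \<omega> \<in> B 0 \<and> S 1 \<omega> \<in> B 1} *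
     (\<Prod>t\<in>{2..n}. T.prob {\<omega> \<in> space N. A t \<omega> \<in> B t}))"
proof -
  let ?rest = "\<lambda>t \<omega>. if t \<le> 1 then S t \<omega> else A t \<omega>"
  \<comment> \<open>Forward independence is known for \<open>h\<close>, not for \<open>A\<close>, so
    the conditions on \<open>A t\<close> are pulled back to conditions on
    \<open>h t\<close>.\<close>
  let ?C = "\<lambda>t. if t \<ge> 2 then {y. sqrt (fac y) \<in> B t} else B t"
  have split: "{r..n} = {r..-1} \<union> {0..n}" using r n by auto
  have split': "{0..n} = {2..n} \<union> {0, 1}" using n by auto
  have C: "?C t \<in> sets borel" if "t \<in> {2..n} \<union> {0, 1}" for t
  proof (cases "t \<ge> 2")
    case True
    have [measurable]: "B t \<in> sets borel" using that r n by (intro B) auto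
    have "{y \<in> space borel. sqrt (fac y) \<in> B t} \<in> sets borel" by measurable
    then show ?thesis using True by simp
  qed (use that r n in \<open>auto intro!: B\<close>)
  have "T.prob {\<omega> \<in> space N. \<forall>t\<in>{r..n}. limit_frame \<omega> t \<in> B t} =
      T.prob {\<omega> \<in> space N. (\<forall>t\<in>{r..-1}. A t \<omega> \<in> B t) \<and> (\<forall>t\<in>{0..n}. ?rest t \<omega> \<in> B t)}"
    unfolding split ball_Un
    by (intro arg_cong[where f=T.prob] Collect_cong conj_cong ball_cong refl) (auto simp: limit_frame_def)
  also have "\<dots> = T.prob {\<omega> \<in> space N. \<forall>t\<in>{r..-1}. A t \<omega> \<in> B t} *
      T.prob {\<omega> \<in> space N. \<forall>t\<in>{0..n}. ?rest t \<omega> \<in> B t}"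
    by (rule T.indep_var_prob_conj[OF T.A_backward_indep_rest]) (use r n in \<open>auto intro!: B\<close>)
  also have "T.prob {\<omega> \<in> space N. \<forall>t\<in>{r..-1}. A t \<omega> \<in> B t} =
      (\<Prod>t\<in>{r..-1}. T.prob {\<omega> \<in> space N. A t \<omega> \<in> B t})"
    by (rule T.indep_vars_prob_Ball[OF T.A_backward_indep]) (use r n in \<open>auto intro!: B\<close>)
  also have "T.prob {\<omega> \<in> space N. \<forall>t\<in>{0..n}. ?rest t \<omega> \<in> B t} =
      T.prob {\<omega> \<in> space N. (\<forall>t\<in>{2..n}. h t \<omega> \<in> ?C t) \<and> (\<forall>t\<in>{0, 1}. S t \<omega> \<in> ?C t)}"
    unfolding split' ball_Un
    by (intro arg_cong[where f=T.prob] Collect_cong conj_cong ball_cong refl) (auto simp: T.A_forward)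
  also have "\<dots> = T.prob {\<omega> \<in> space N. \<forall>t\<in>{2..n}. h t \<omega> \<in> ?C t} *
      T.prob {\<omega> \<in> space N. \<forall>t\<in>{0, 1}. S t \<omega> \<in> ?C t}"
    by (rule T.indep_var_prob_conj[OF T.h_indep_start]) (use C in auto)
  also have "T.prob {\<omega> \<in> space N. \<forall>t\<in>{2..n}. h t \<omega> \<in> ?C t} =
      (\<Prod>t\<in>{2..n}. T.prob {\<omega> \<in> space N. h t \<omega> \<in> ?C t})"
    by (rule T.indep_vars_prob_Ball[OF T.h_indep], simp, force, rule C, simp)
  also have "\<dots> = (\<Prod>t\<in>{2..n}. T.prob {\<omega> \<in> space N. A t \<omega> \<in> B t})"
    by (intro prod.cong arg_cong[where f=T.prob] Collect_cong refl) (auto simp: T.A_forward)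
  also have "T.prob {\<omega> \<in> space N. \<forall>t\<in>{0, 1}. S t \<omega> \<in> ?C t} =
      T.prob {\<omega> \<in> space N. S 0 \<omega> \<in> B 0 \<and> S 1 \<omega> \<in> B 1}"
    by simp
  finally show ?thesis by (simp only: mult_ac)
qed

text \<open>The weight and the box indicator both split over the innovations, so the expectation of
  the product is a product of expectations. Each innovation up to time 0 brings the density of a
  backward factor, epsilon_1 brings the start pair and the constant, and later ones are plain
  forward factors.\<close>

lemma noise_frame_box:
  assumes r: "r \<le> 0" and n: "n \<ge> 1" and B: "\<And>t. t \<in> {r..n} \<Longrightarrow> B t \<in> sets borel"
  shows "(\<integral>\<^sup>+\<omega>. \<integral>\<^sup>+z. ennreal (tilt r \<omega>) * (\<Prod>t\<in>{r..n}. indicator (B t) (noise_frame \<omega> z t)) \<partial>pareto_law \<partial>M) =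
    ennreal tilt_const * ennreal (T.prob {\<omega> \<in> space N. \<forall>t\<in>{r..n}. limit_frame \<omega> t \<in> B t})"
proof -
  interpret P: real_distribution pareto_law by (rule real_distribution_pareto_law)
  \<comment> \<open>The index j counts innovations, from r + 1 to n, one fewer than the coordinates
    from r to n: coordinates 0 and 1 both belong to j = 1, and a backward coordinate t belongs to j
    = t + 1.\<close>
  define g :: "int \<Rightarrow> real \<Rightarrow> ennreal" where "g j y =
    (if j \<ge> 2 then indicator (B j) (sqrt (fac y))
     else if j = 1 then ennreal (\<bar>y\<bar> powr (2 * \<alpha>)) * start_mass (B 0) (B 1) \<bar>y\<bar>
     else ennreal (fac y powr \<alpha>) * indicator (B (j - 1)) (1 / sqrt (fac y)))" for j y
  have B01 [measurable]: "B 0 \<in> sets borel" "B 1 \<in> sets borel" using r n by (auto intro!: B)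
  have g_meas: "g j \<in> borel_measurable borel" if "j \<in> {r+1..n}" for j
  proof -
    consider "j \<ge> 2" | "j = 1" | "j \<le> 0" by linarith
    then show ?thesis
    proof cases
      case 1
      then have [measurable]: "B j \<in> sets borel" using that by (intro B) auto
      show ?thesis unfolding g_def[abs_def] using 1 by simp
    next
      case 3
      then have [measurable]: "B (j - 1) \<in> sets borel" using that by (intro B) auto
      show ?thesis unfolding g_def[abs_def] using 3 by simp
    qed (simp add: g_def[abs_def])
  qed
  have split: "{r..n} = {r..-1} \<union> ({0, 1} \<union> {2..n})" using r n by auto
  have split': "{r+1..n} = {r+1..0} \<union> ({1} \<union> {2..n})" using r n by auto
  have shift: "(\<Prod>t\<in>{r..-1}. F t) = (\<Prod>j\<in>{r+1..0}. F (j - 1))" for F :: "int \<Rightarrow> ennreal"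
    by (rule prod.reindex_bij_witness[of _ "\<lambda>j. j - 1" "\<lambda>t. t + 1"]) auto
  have inner: "(\<integral>\<^sup>+z. ennreal (tilt r \<omega>) * (\<Prod>t\<in>{r..n}. indicator (B t) (noise_frame \<omega> z t)) \<partial>pareto_law) =
      (\<Prod>j\<in>{r+1..n}. g j (\<epsilon> j \<omega>))" for \<omega>
  proof -
    let ?b = "\<Prod>j\<in>{r+1..0}. indicator (B (j - 1)) (1 / sqrt (fac (\<epsilon> j \<omega>))) :: ennreal"
    let ?f = "\<Prod>t\<in>{2..n}. indicator (B t) (sqrt (fac (\<epsilon> t \<omega>))) :: ennreal"
    let ?s = "\<lambda>z. indicator (B 0) (z / \<bar>\<epsilon> 1 \<omega>\<bar>) * indicator (B 1) (z / \<bar>\<epsilon> 1 \<omega>\<bar> * sqrt (fac (\<epsilon> 1 \<omega>))) :: ennreal"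
    have "(\<Prod>t\<in>{r..n}. indicator (B t) (noise_frame \<omega> z t)) = ?b * (?s z * ?f)" for z
    proof -
      have "(\<Prod>t\<in>{r..n}. indicator (B t) (noise_frame \<omega> z t)) =
          (\<Prod>t\<in>{r..-1}. indicator (B t) (noise_frame \<omega> z t)) *
          ((\<Prod>t\<in>{0, 1}. indicator (B t) (noise_frame \<omega> z t)) *
           (\<Prod>t\<in>{2..n}. indicator (B t) (noise_frame \<omega> z t) :: ennreal))"
        unfolding split by (subst prod.union_disjoint, simp, simp, force, subst prod.union_disjoint) auto
      also have "(\<Prod>t\<in>{r..-1}. indicator (B t) (noise_frame \<omega> z t)) = ?b"
        unfolding shift by (intro prod.cong refl) (auto simp: noise_frame_def)
      also have "(\<Prod>t\<in>{0, 1}. indicator (B t) (noise_frame \<omega> z t)) = ?s z"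
        by (simp add: noise_frame_def)
      also have "(\<Prod>t\<in>{2..n}. indicator (B t) (noise_frame \<omega> z t)) = ?f"
        by (intro prod.cong refl) (auto simp: noise_frame_def)
      finally show ?thesis .
    qed
    then have "(\<integral>\<^sup>+z. ennreal (tilt r \<omega>) * (\<Prod>t\<in>{r..n}. indicator (B t) (noise_frame \<omega> z t)) \<partial>pareto_law) =
        (\<integral>\<^sup>+z. (ennreal (tilt r \<omega>) * ?b * ?f) * ?s z \<partial>pareto_law)"
      by (simp add: mult_ac)
    also have "\<dots> = (ennreal (tilt r \<omega>) * ?b * ?f) * start_mass (B 0) (B 1) \<bar>\<epsilon> 1 \<omega>\<bar>"
      unfolding start_mass_def by (subst nn_integral_cmult) auto
    also have "\<dots> = ((\<Prod>j\<in>{r+1..0}. ennreal (fac (\<epsilon> j \<omega>) powr \<alpha>)) * ?b) * (ennreal (\<bar>\<epsilon> 1 \<omega>\<bar> powr (2 * \<alpha>)) *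
        start_mass (B 0) (B 1) \<bar>\<epsilon> 1 \<omega>\<bar> * ?f)"
    proof -
      have "ennreal (tilt r \<omega>) =
          (\<Prod>j\<in>{r+1..0}. ennreal (fac (\<epsilon> j \<omega>) powr \<alpha>)) * ennreal (\<bar>\<epsilon> 1 \<omega>\<bar> powr (2 * \<alpha>))"
        unfolding tilt_eq by (simp add: ennreal_mult'' prod_ennreal)
      then show ?thesis by (simp only: mult_ac)
    qed
    also have "\<dots> = (\<Prod>j\<in>{r+1..0}. g j (\<epsilon> j \<omega>)) * ((\<Prod>j\<in>{1}. g j (\<epsilon> j \<omega>)) * (\<Prod>j\<in>{2..n}. g j (\<epsilon> j \<omega>)))"
      unfolding prod.distrib[symmetric]
      by (intro arg_cong2[where f="(*)"] prod.cong refl) (auto simp: g_def)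
    also have "\<dots> = (\<Prod>j\<in>{r+1..n}. g j (\<epsilon> j \<omega>))"
      unfolding split' by (subst prod.union_disjoint, simp, simp, force, subst prod.union_disjoint) auto
    finally show ?thesis .
  qed
  have ind: "indep_vars (\<lambda>_. borel) (\<lambda>j \<omega>. g j (\<epsilon> j \<omega>)) {r+1..n}"
    by (rule indep_vars_compose2[OF indep_vars_subset[OF \<epsilon>_indep]]) (use g_meas in auto)
  have "(\<integral>\<^sup>+\<omega>. \<integral>\<^sup>+z. ennreal (tilt r \<omega>) * (\<Prod>t\<in>{r..n}. indicator (B t) (noise_frame \<omega> z t)) \<partial>pareto_law \<partial>M) =
      (\<Prod>j\<in>{r+1..n}. \<integral>\<^sup>+\<omega>. g j (\<epsilon> j \<omega>) \<partial>M)"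
    unfolding inner by (rule indep_vars_nn_integral[OF _ ind]) auto
  also have "\<dots> = (\<Prod>j\<in>{r+1..0}. \<integral>\<^sup>+\<omega>. g j (\<epsilon> j \<omega>) \<partial>M) *
      ((\<Prod>j\<in>{1}. \<integral>\<^sup>+\<omega>. g j (\<epsilon> j \<omega>) \<partial>M) * (\<Prod>j\<in>{2..n}. \<integral>\<^sup>+\<omega>. g j (\<epsilon> j \<omega>) \<partial>M))"
    unfolding split' by (subst prod.union_disjoint, simp, simp, force, subst prod.union_disjoint) auto
  also have "(\<Prod>j\<in>{r+1..0}. \<integral>\<^sup>+\<omega>. g j (\<epsilon> j \<omega>) \<partial>M) =
      (\<Prod>t\<in>{r..-1}. ennreal (T.prob {\<omega> \<in> space N. A t \<omega> \<in> B t}))"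
    unfolding shift
  proof (rule prod.cong[OF refl])
    fix j assume j: "j \<in> {r+1..0}"
    then have [measurable]: "B (j - 1) \<in> sets borel" using n by (intro B) auto
    have [measurable]: "A (j - 1) \<in> borel_measurable N" using j by (intro A_measurable) auto
    have "(\<integral>\<^sup>+\<omega>. g j (\<epsilon> j \<omega>) \<partial>M) =
        (\<integral>\<^sup>+\<omega>. ennreal (fac (\<epsilon> j \<omega>) powr \<alpha>) * indicator (B (j - 1)) (1 / sqrt (fac (\<epsilon> j \<omega>))) \<partial>M)"
      using j by (intro nn_integral_cong) (auto simp: g_def)
    also have "\<dots> = (\<integral>\<^sup>+\<omega>. indicator (B (j - 1)) (A (j - 1) \<omega>) \<partial>N)"
      by (rule nn_integral_backward_factor) (use j in auto)
    also have "\<dots> = (\<integral>\<^sup>+\<omega>. indicator {\<omega> \<in> space N. A (j - 1) \<omega> \<in> B (j - 1)} \<omega> \<partial>N)"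
      by (rule nn_integral_cong) (auto split: split_indicator)
    also have "\<dots> = ennreal (T.prob {\<omega> \<in> space N. A (j - 1) \<omega> \<in> B (j - 1)})"
      by (subst nn_integral_indicator) (auto simp: T.emeasure_eq_measure)
    finally show "(\<integral>\<^sup>+\<omega>. g j (\<epsilon> j \<omega>) \<partial>M) = \<dots>" .
  qed
  also have "(\<Prod>j\<in>{1}. \<integral>\<^sup>+\<omega>. g j (\<epsilon> j \<omega>) \<partial>M) =
      ennreal tilt_const * ennreal (T.prob {\<omega> \<in> space N. S 0 \<omega> \<in> B 0 \<and> S 1 \<omega> \<in> B 1})"
    by (simp add: g_def nn_integral_tilted_\<epsilon> start_mass_eq_prob)
  also have "(\<Prod>j\<in>{2..n}. \<integral>\<^sup>+\<omega>. g j (\<epsilon> j \<omega>) \<partial>M) =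
      (\<Prod>t\<in>{2..n}. ennreal (T.prob {\<omega> \<in> space N. A t \<omega> \<in> B t}))"
  proof (rule prod.cong[OF refl])
    fix j assume j: "j \<in> {2..n}"
    then have [measurable]: "B j \<in> sets borel" using r by (intro B) auto
    have [measurable]: "A j \<in> borel_measurable N" using j by (intro A_measurable) auto
    have "(\<integral>\<^sup>+\<omega>. g j (\<epsilon> j \<omega>) \<partial>M) = (\<integral>\<^sup>+\<omega>. indicator (B j) (sqrt (fac (\<epsilon> j \<omega>))) \<partial>M)"
      using j by (intro nn_integral_cong) (auto simp: g_def)
    also have "\<dots> = (\<integral>\<^sup>+\<omega>. indicator (B j) (A j \<omega>) \<partial>N)"
      by (rule nn_integral_forward_factor) (use j in auto)
    also have "\<dots> = (\<integral>\<^sup>+\<omega>. indicator {\<omega> \<in> space N. A j \<omega> \<in> B j} \<omega> \<partial>N)"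
      by (rule nn_integral_cong) (auto split: split_indicator)
    also have "\<dots> = ennreal (T.prob {\<omega> \<in> space N. A j \<omega> \<in> B j})"
      by (subst nn_integral_indicator) (auto simp: T.emeasure_eq_measure)
    finally show "(\<integral>\<^sup>+\<omega>. g j (\<epsilon> j \<omega>) \<partial>M) = \<dots>" .
  qed
  moreover have "T.prob {\<omega> \<in> space N. \<forall>t\<in>{r..n}. limit_frame \<omega> t \<in> B t} =
    (\<Prod>t\<in>{r..-1}. T.prob {\<omega> \<in> space N. A t \<omega> \<in> B t}) *
    (T.prob {\<omega> \<in> space N. S 0 \<omega> \<in> B 0 \<and> S 1 \<omega> \<in> B 1} *
     (\<Prod>t\<in>{2..n}. T.prob {\<omega> \<in> space N. A t \<omega> \<in> B t}))"
    by (rule limit_frame_box[OF r n B])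
  ultimately show ?thesis
    by (simp add: ennreal_mult'' ennreal_mult' prod_ennreal prod_nonneg mult_ac)
qed

text \<open>Both measures are finite, of mass \<open>tilt_const\<close>, and boxes form a generator
  stable under intersection, so agreement on boxes decides. This is the change of measure in one
  statement: the weighted noise frame has, up to its mass, the law of the limit frame.\<close>

lemma frame_law:
  assumes r: "r \<le> 0" and n: "n \<ge> 1"
  shows "distr (density (M \<Otimes>\<^sub>M pareto_law) (\<lambda>p. ennreal (tilt r (fst p)))) (\<Pi>\<^sub>M t\<in>{r..n}. borel)
      (\<lambda>p. \<lambda>t\<in>{r..n}. noise_frame (fst p) (snd p) t) =
    density (distr N (\<Pi>\<^sub>M t\<in>{r..n}. borel) (\<lambda>\<omega>. \<lambda>t\<in>{r..n}. limit_frame \<omega> t)) (\<lambda>_. ennreal tilt_const)"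
    (is "?P = ?Q")
proof (rule measure_eqI_PiM_finite[where I="{r..n}" and M="\<lambda>_. borel" and A="\<lambda>_. Pi\<^sub>E {r..n} (\<lambda>_. UNIV)"])
  interpret P: real_distribution pareto_law by (rule real_distribution_pareto_law)
  have nf [measurable]: "(\<lambda>p. \<lambda>t\<in>{r..n}. noise_frame (fst p) (snd p) t) \<in> M \<Otimes>\<^sub>M pareto_law \<rightarrow>\<^sub>M (\<Pi>\<^sub>M t\<in>{r..n}. borel)"
    by (rule measurable_restrict) (rule noise_frame_measurable)
  have lf [measurable]: "(\<lambda>\<omega>. \<lambda>t\<in>{r..n}. limit_frame \<omega> t) \<in> N \<rightarrow>\<^sub>M (\<Pi>\<^sub>M t\<in>{r..n}. borel)"
    by (rule measurable_restrict) (rule limit_frame_measurable)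
  have box: "?P (Pi\<^sub>E {r..n} B) = ?Q (Pi\<^sub>E {r..n} B)" "?P (Pi\<^sub>E {r..n} B) \<noteq> \<infinity>"
    if B: "\<And>t. t \<in> {r..n} \<Longrightarrow> B t \<in> sets borel" for B
  proof -
    have BE [measurable]: "Pi\<^sub>E {r..n} B \<in> sets (\<Pi>\<^sub>M t\<in>{r..n}. borel)"
      using B by (intro sets_PiM_I_finite) auto
    have "?P (Pi\<^sub>E {r..n} B) = (\<integral>\<^sup>+p. ennreal (tilt r (fst p)) *
        indicator (Pi\<^sub>E {r..n} B) (\<lambda>t\<in>{r..n}. noise_frame (fst p) (snd p) t) \<partial>(M \<Otimes>\<^sub>M pareto_law))"
      by (subst nn_integral_indicator[symmetric], simp, subst nn_integral_distr, simp, simp, subst nn_integral_density) auto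
    also have "\<dots> = (\<integral>\<^sup>+\<omega>. \<integral>\<^sup>+z. ennreal (tilt r \<omega>) *
        indicator (Pi\<^sub>E {r..n} B) (\<lambda>t\<in>{r..n}. noise_frame \<omega> z t) \<partial>pareto_law \<partial>M)"
      by (subst P.nn_integral_fst[symmetric]) auto
    also have "\<dots> = (\<integral>\<^sup>+\<omega>. \<integral>\<^sup>+z. ennreal (tilt r \<omega>) * (\<Prod>t\<in>{r..n}. indicator (B t) (noise_frame \<omega> z t)) \<partial>pareto_law \<partial>M)"
    proof (intro nn_integral_cong arg_cong2[where f="(*)"] refl)
      fix \<omega> z
      show "indicator (Pi\<^sub>E {r..n} B) (\<lambda>t\<in>{r..n}. noise_frame \<omega> z t) =
          (\<Prod>t\<in>{r..n}. indicator (B t) (noise_frame \<omega> z t) :: ennreal)"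
      proof (cases "\<forall>t\<in>{r..n}. noise_frame \<omega> z t \<in> B t")
        case True
        then show ?thesis by simp
      next
        case False
        then obtain t where "t \<in> {r..n}" "noise_frame \<omega> z t \<notin> B t" by blast
        then have "(\<Prod>t\<in>{r..n}. indicator (B t) (noise_frame \<omega> z t) :: ennreal) = 0"
          by (intro prod_zero bexI[of _ t]) auto
        moreover have "(\<lambda>t\<in>{r..n}. noise_frame \<omega> z t) \<notin> Pi\<^sub>E {r..n} B"
          using \<open>t \<in> {r..n}\<close> \<open>noise_frame \<omega> z t \<notin> B t\<close> by (auto simp: PiE_iff)
        ultimately show ?thesis by simp
      qed
    qed
    also have "\<dots> = ennreal tilt_const * ennreal (T.prob {\<omega> \<in> space N. \<forall>t\<in>{r..n}. limit_frame \<omega> t \<in> B t})"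
      by (rule noise_frame_box[OF r n B])
    finally have P: "?P (Pi\<^sub>E {r..n} B) = \<dots>" .
    then show "?P (Pi\<^sub>E {r..n} B) \<noteq> \<infinity>" by (simp flip: ennreal_mult'')
    have "?Q (Pi\<^sub>E {r..n} B) = ennreal tilt_const * emeasure (distr N (\<Pi>\<^sub>M t\<in>{r..n}. borel) (\<lambda>\<omega>. \<lambda>t\<in>{r..n}. limit_frame \<omega> t)) (Pi\<^sub>E {r..n} B)"
      by (rule emeasure_density_const) simp
    also have "emeasure (distr N (\<Pi>\<^sub>M t\<in>{r..n}. borel) (\<lambda>\<omega>. \<lambda>t\<in>{r..n}. limit_frame \<omega> t)) (Pi\<^sub>E {r..n} B) =
        ennreal (T.prob {\<omega> \<in> space N. \<forall>t\<in>{r..n}. limit_frame \<omega> t \<in> B t})"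
      by (subst emeasure_distr) (auto simp: T.emeasure_eq_measure PiE_iff intro!: arg_cong[where f=T.prob])
    finally have Q: "?Q (Pi\<^sub>E {r..n} B) = ennreal tilt_const *
        ennreal (T.prob {\<omega> \<in> space N. \<forall>t\<in>{r..n}. limit_frame \<omega> t \<in> B t})" .
    show "?P (Pi\<^sub>E {r..n} B) = ?Q (Pi\<^sub>E {r..n} B)" by (rule trans[OF P Q[symmetric]])
  qed
  show "?P (Pi\<^sub>E {r..n} B) = ?Q (Pi\<^sub>E {r..n} B)" if "\<And>i. i \<in> {r..n} \<Longrightarrow> B i \<in> sets borel" for B
    using that by (rule box(1))
  show "?P (Pi\<^sub>E {r..n} (\<lambda>_. UNIV)) \<noteq> \<infinity>" for i :: nat by (rule box(2)) simp
  show "range (\<lambda>_::nat. Pi\<^sub>E {r..n} (\<lambda>_. UNIV)) \<subseteq> prod_algebra {r..n} (\<lambda>_. borel)"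
    by (auto intro!: prod_algebraI_finite)
qed (auto simp: space_PiM)

end

section \<open>From frames back to volatility paths\<close>

definition path_of_frame :: "(int \<Rightarrow> real) \<Rightarrow> int \<Rightarrow> real" where
  "path_of_frame v t = (if t \<le> 0 then v 0 * (\<Prod>j\<in>{t..-1}. v j) else v 1 * (\<Prod>j\<in>{2..t}. v j))"

lemma path_of_frame_restrict:
  assumes "r \<le> 0" "n \<ge> 1" "t \<in> {r..n}"
  shows "path_of_frame (\<lambda>t\<in>{r..n}. v t) t = path_of_frame v t"
  unfolding path_of_frame_def using assms by (auto intro!: prod.cong)

context garch11_limit
begin

lemma path_of_limit_frame:
  assumes \<omega>: "\<omega> \<in> space N"
  shows "path_of_frame (limit_frame \<omega>) t = S t \<omega>"
proof (cases "t \<le> 0")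
  case True
  have "path_of_frame (limit_frame \<omega>) (- int k) = S (- int k) \<omega>" for k
  proof (induction k)
    case (Suc k)
    have "{- int (Suc k)..-1} = insert (- int (Suc k)) {- int k..-1}" by auto
    then have "path_of_frame (limit_frame \<omega>) (- int (Suc k)) =
        path_of_frame (limit_frame \<omega>) (- int k) * A (- int (Suc k)) \<omega>"
      by (simp add: path_of_frame_def limit_frame_def)
    also have "\<dots> = S (- int (Suc k) + 1) \<omega> * A (- int (Suc k)) \<omega>" by (simp add: Suc)
    also have "\<dots> = S (- int (Suc k)) \<omega>"
      by (rule T.S_backward[OF _ \<omega>, symmetric]) simp
    finally show ?case .
  qed (simp add: path_of_frame_def limit_frame_def)
  from this[of "nat (- t)"] show ?thesis using True by simp
next
  case False
  have "path_of_frame (limit_frame \<omega>) (1 + int k) = S (1 + int k) \<omega>" for k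
  proof (induction k)
    case (Suc k)
    have "{2..1 + int (Suc k)} = insert (1 + int (Suc k)) {2..1 + int k}" by auto
    then have "path_of_frame (limit_frame \<omega>) (1 + int (Suc k)) =
        path_of_frame (limit_frame \<omega>) (1 + int k) * A (1 + int (Suc k)) \<omega>"
      by (simp add: path_of_frame_def limit_frame_def)
    also have "\<dots> = S (1 + int (Suc k) - 1) \<omega> * A (1 + int (Suc k)) \<omega>" by (simp add: Suc)
    also have "\<dots> = S (1 + int (Suc k)) \<omega>"
      by (rule T.S_forward[OF _ \<omega>, symmetric]) simp
    finally show ?case .
  qed (simp add: path_of_frame_def limit_frame_def)
  from this[of "nat (t - 1)"] show ?thesis using False by simp
qed

lemma S_measurable [measurable]: "S t \<in> borel_measurable N"
  by (subst measurable_cong[OF path_of_limit_frame[symmetric]]) (auto simp: path_of_frame_def)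

lemma sqrt_prod: "sqrt (\<Prod>j\<in>J. F j) = (\<Prod>j\<in>J. sqrt (F j))"
  by (induction J rule: infinite_finite_induct) (simp_all add: real_sqrt_mult)

text \<open>Cancellation against d. For t <= 0 the denominator contains all factors of the numerator
  and leaves the reciprocals at times t + 1, ..., 0; for t > 0 the numerator contains those of the
  denominator and leaves the factors at 1, ..., t. Nonzero innovations make the cancelled factors
  nonzero, and the starting time r drops out.\<close>

lemma path_of_noise_frame:
  assumes r: "r \<le> 0" and t: "r \<le> t" and nz: "\<And>j. \<epsilon> j \<omega> \<noteq> 0"
  shows "path_of_frame (noise_frame \<omega> z) t =
    z * sqrt (cprod r (\<lambda>t. \<epsilon> t \<omega>) (nat (t - r))) / (sqrt (cprod r (\<lambda>t. \<epsilon> t \<omega>) (nat (- r))) * \<bar>\<epsilon> 1 \<omega>\<bar>)"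
proof -
  let ?s = "\<lambda>j. sqrt (fac (\<epsilon> j \<omega>))"
  have s: "?s j \<noteq> 0" for j using fac_pos[OF nz[of j]] by simp
  have sq: "sqrt (cprod r (\<lambda>t. \<epsilon> t \<omega>) (nat (t - r))) = (\<Prod>j\<in>{r+1..t}. ?s j)" for t
    unfolding cprod_eq_prod sqrt_prod ..
  have sq0: "sqrt (cprod r (\<lambda>t. \<epsilon> t \<omega>) (nat (- r))) = (\<Prod>j\<in>{r+1..0}. ?s j)"
    using sq[of 0] by simp
  show ?thesis
  proof (cases "t \<le> 0")
    case True
    have "{r+1..0} = {r+1..t} \<union> {t+1..0}" using True t by auto
    then have P: "(\<Prod>j\<in>{r+1..0}. ?s j) = (\<Prod>j\<in>{r+1..t}. ?s j) * (\<Prod>j\<in>{t+1..0}. ?s j)"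
      by (simp add: prod.union_disjoint)
    have "path_of_frame (noise_frame \<omega> z) t = z / \<bar>\<epsilon> 1 \<omega>\<bar> * (\<Prod>j\<in>{t..-1}. 1 / ?s (j + 1))"
      using True by (auto simp: path_of_frame_def noise_frame_def intro!: prod.cong)
    also have "(\<Prod>j\<in>{t..-1}. 1 / ?s (j + 1)) = (\<Prod>j\<in>{t+1..0}. 1 / ?s j)"
      by (rule prod.reindex_bij_witness[of _ "\<lambda>j. j - 1" "\<lambda>j. j + 1"]) auto
    also have "\<dots> = 1 / (\<Prod>j\<in>{t+1..0}. ?s j)" by (simp add: prod_dividef)
    finally show ?thesis unfolding sq sq0 P using s by (simp add: field_simps)
  next
    case False
    have "{r+1..t} = {r+1..0} \<union> ({1} \<union> {2..t})" using False r by auto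
    then have P: "(\<Prod>j\<in>{r+1..t}. ?s j) = (\<Prod>j\<in>{r+1..0}. ?s j) * (?s 1 * (\<Prod>j\<in>{2..t}. ?s j))"
      by (simp add: prod.union_disjoint)
    have "path_of_frame (noise_frame \<omega> z) t = z / \<bar>\<epsilon> 1 \<omega>\<bar> * ?s 1 * (\<Prod>j\<in>{2..t}. ?s j)"
      using False by (auto simp: path_of_frame_def noise_frame_def intro!: prod.cong)
    then show ?thesis unfolding sq sq0 P using s by (simp add: field_simps)
  qed
qed

text \<open>Both sides integrate the same functional F of a frame, once under the weighted noise
  frame and once under the limit frame, so \<open>frame_law\<close> identifies them.\<close>

lemma tilted_expectation:
  fixes f :: "(int \<Rightarrow> real) \<Rightarrow> real"
  assumes f: "continuous_on UNIV f" and B: "\<And>y. \<bar>f y\<bar> \<le> B"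
    and r: "r \<le> 0" and n: "n \<ge> 1" and I: "I \<subseteq> {r..n}"
  defines "d \<equiv> \<lambda>\<omega>. sqrt (cprod r (\<lambda>t. \<epsilon> t \<omega>) (nat (- r))) * \<bar>\<epsilon> 1 \<omega>\<bar>"
  shows "(\<integral>\<omega>. d \<omega> powr (2 * \<alpha>) *
      (\<integral>z. f (\<lambda>t\<in>I. z * sqrt (cprod r (\<lambda>t. \<epsilon> t \<omega>) (nat (t - r))) / d \<omega>) \<partial>pareto_law) \<partial>M) =
    tilt_const * (\<integral>\<omega>. f (\<lambda>t\<in>I. S t \<omega>) \<partial>N)"
proof -
  interpret P: real_distribution pareto_law by (rule real_distribution_pareto_law)
  interpret MP: pair_prob_space M pareto_law ..
  let ?T = "\<Pi>\<^sub>M t\<in>{r..n}. (borel :: real measure)"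
  let ?nf = "\<lambda>p. \<lambda>t\<in>{r..n}. noise_frame (fst p) (snd p) t"
  let ?lf = "\<lambda>\<omega>. \<lambda>t\<in>{r..n}. limit_frame \<omega> t"
  let ?D = "density (M \<Otimes>\<^sub>M pareto_law) (\<lambda>p. ennreal (tilt r (fst p)))"
  define F where "F v = f (\<lambda>t\<in>I. path_of_frame v t)" for v
  have nf [measurable]: "?nf \<in> M \<Otimes>\<^sub>M pareto_law \<rightarrow>\<^sub>M ?T"
    by (rule measurable_restrict) (rule noise_frame_measurable)
  have lf [measurable]: "?lf \<in> N \<rightarrow>\<^sub>M ?T"
    by (rule measurable_restrict) (rule limit_frame_measurable)
  have F_meas [measurable]: "F \<in> borel_measurable ?T"
    unfolding F_def
  proof (rule borel_measurable_continuous_restrict[OF f])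
    fix t assume "t \<in> I"
    with I have t: "t \<in> {r..n}" by auto
    have comp: "(\<lambda>v. v j) \<in> borel_measurable ?T" if "j \<in> {r..n}" for j
      using that by (rule measurable_component_singleton)
    show "(\<lambda>v. path_of_frame v t) \<in> borel_measurable ?T"
    proof (cases "t \<le> 0")
      case True
      then show ?thesis unfolding path_of_frame_def using t r n
        by (auto intro!: borel_measurable_times borel_measurable_prod comp)
    next
      case False
      then show ?thesis unfolding path_of_frame_def using t r n
        by (auto intro!: borel_measurable_times borel_measurable_prod comp)
    qed
  qed
  have F_restrict: "F (\<lambda>t\<in>{r..n}. v t) = f (\<lambda>t\<in>I. path_of_frame v t)" for v
    unfolding F_def using I by (intro arg_cong[where f=f] restrict_ext path_of_frame_restrict r n) auto
  have tilt_nonneg: "tilt r \<omega> \<ge> 0" for \<omega> by (simp add: tilt_def)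
  \<comment> \<open>Integrability of the weight, needed to merge the iterated integral, is read off
    the law of the frame: its total mass is \<open>tilt_const\<close>.\<close>
  have tilt_int: "integrable (M \<Otimes>\<^sub>M pareto_law) (\<lambda>p. tilt r (fst p))"
  proof (rule integrableI_nonneg)
    have "(\<integral>\<^sup>+p. ennreal (tilt r (fst p)) \<partial>(M \<Otimes>\<^sub>M pareto_law)) = emeasure ?D (space (M \<Otimes>\<^sub>M pareto_law))"
      by (subst emeasure_density[OF _ sets.top]) (auto intro!: nn_integral_cong)
    also have "\<dots> = emeasure (distr ?D ?T ?nf) (space ?T)"
    proof -
      have "?nf -` space ?T \<inter> space ?D = space (M \<Otimes>\<^sub>M pareto_law)"
        using measurable_space[OF nf] by (auto simp del: restrict_apply)
      then show ?thesis by (subst emeasure_distr) auto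
    qed
    also have "\<dots> = ennreal tilt_const"
    proof -
      interpret L: prob_space "distr N ?T ?lf" by (rule T.prob_space_distr) simp
      show ?thesis unfolding frame_law[OF r n]
        using L.emeasure_space_1 by (subst emeasure_density_const) auto
    qed
    finally show "(\<integral>\<^sup>+p. ennreal (tilt r (fst p)) \<partial>(M \<Otimes>\<^sub>M pareto_law)) < \<infinity>" by simp
  qed (auto simp: tilt_nonneg)
  have "(\<integral>\<omega>. d \<omega> powr (2 * \<alpha>) *
      (\<integral>z. f (\<lambda>t\<in>I. z * sqrt (cprod r (\<lambda>t. \<epsilon> t \<omega>) (nat (t - r))) / d \<omega>) \<partial>pareto_law) \<partial>M) =
      (\<integral>\<omega>. \<integral>z. tilt r \<omega> * F (?nf (\<omega>, z)) \<partial>pareto_law \<partial>M)"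
  proof (rule integral_cong_AE)
    show "AE \<omega> in M. d \<omega> powr (2 * \<alpha>) *
        (\<integral>z. f (\<lambda>t\<in>I. z * sqrt (cprod r (\<lambda>t. \<epsilon> t \<omega>) (nat (t - r))) / d \<omega>) \<partial>pareto_law) =
        (\<integral>z. tilt r \<omega> * F (?nf (\<omega>, z)) \<partial>pareto_law)"
      using AE_\<epsilon>_nonzero
    proof eventually_elim
      case (elim \<omega>)
      have "F (?nf (\<omega>, z)) = f (\<lambda>t\<in>I. z * sqrt (cprod r (\<lambda>t. \<epsilon> t \<omega>) (nat (t - r))) / d \<omega>)" for z
        unfolding F_restrict d_def using I elim
        by (intro arg_cong[where f=f] restrict_ext) (auto intro!: path_of_noise_frame[OF r])
      then show ?case by (simp add: tilt_def d_def)
    qed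
    have [measurable]: "(\<lambda>p. f (\<lambda>t\<in>I. snd p * sqrt (cprod r (\<lambda>t. \<epsilon> t (fst p)) (nat (t - r))) / d (fst p)))
        \<in> borel_measurable (M \<Otimes>\<^sub>M pareto_law)"
      by (rule borel_measurable_continuous_restrict[OF f]) (unfold d_def cprod_def, measurable)
    have "(\<lambda>\<omega>. \<integral>z. f (\<lambda>t\<in>I. z * sqrt (cprod r (\<lambda>t. \<epsilon> t \<omega>) (nat (t - r))) / d \<omega>) \<partial>pareto_law) \<in> borel_measurable M"
      by (rule P.borel_measurable_lebesgue_integral) (simp add: case_prod_beta')
    then show "(\<lambda>\<omega>. d \<omega> powr (2 * \<alpha>) *
        (\<integral>z. f (\<lambda>t\<in>I. z * sqrt (cprod r (\<lambda>t. \<epsilon> t \<omega>) (nat (t - r))) / d \<omega>) \<partial>pareto_law)) \<in> borel_measurable M"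
      unfolding d_def cprod_def by measurable
    have "(\<lambda>p. tilt r (fst p) * F (?nf p)) \<in> borel_measurable (M \<Otimes>\<^sub>M pareto_law)"
      by measurable
    then show "(\<lambda>\<omega>. \<integral>z. tilt r \<omega> * F (?nf (\<omega>, z)) \<partial>pareto_law) \<in> borel_measurable M"
      by (intro P.borel_measurable_lebesgue_integral) (simp add: case_prod_beta')
  qed
  also have "\<dots> = (\<integral>p. tilt r (fst p) * F (?nf p) \<partial>(M \<Otimes>\<^sub>M pareto_law))"
  proof -
    have "integrable (M \<Otimes>\<^sub>M pareto_law) (\<lambda>p. tilt r (fst p) * F (?nf p))"
    proof (rule Bochner_Integration.integrable_bound[OF integrable_mult_left[OF tilt_int, of B]])
      show "AE p in M \<Otimes>\<^sub>M pareto_law. norm (tilt r (fst p) * F (?nf p)) \<le> norm (tilt r (fst p) * B)"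
        using B by (intro AE_I2) (auto simp: abs_mult F_def tilt_nonneg intro!: mult_left_mono order_trans[OF B])
    qed measurable
    from MP.integral_fst'[OF this] show ?thesis by simp
  qed
  also have "\<dots> = (\<integral>p. F (?nf p) \<partial>?D)"
    by (subst integral_density) (auto simp: tilt_nonneg)
  also have "\<dots> = (\<integral>v. F v \<partial>distr ?D ?T ?nf)"
    by (rule integral_distr[symmetric]) (simp only: measurable_density_eq1 nf, rule F_meas)
  also have "\<dots> = tilt_const * (\<integral>v. F v \<partial>distr N ?T ?lf)"
    unfolding frame_law[OF r n] using tilt_const_pos by (subst integral_density) auto
  also have "(\<integral>v. F v \<partial>distr N ?T ?lf) = (\<integral>\<omega>. F (?lf \<omega>) \<partial>N)"
    by (rule integral_distr) (rule lf, rule F_meas)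
  also have "\<dots> = (\<integral>\<omega>. f (\<lambda>t\<in>I. S t \<omega>) \<partial>N)"
    unfolding F_restrict by (intro Bochner_Integration.integral_cong) (simp_all add: path_of_limit_frame cong: restrict_cong)
  finally show ?thesis .
qed

text \<open>A quotient of two instances of the same limit, one for f and one for the constant 1.
  Both the normalisation by the tail of sigma_0 and the mass of the weight cancel.\<close>

lemma conditional_expectation_tendsto:
  fixes f :: "(int \<Rightarrow> real) \<Rightarrow> real"
  assumes f: "continuous_on UNIV f" and B: "\<And>y. \<bar>f y\<bar> \<le> B"
    and r: "r \<le> 0" and n: "n \<ge> 1" and I: "I \<subseteq> {r..n}"
  shows "((\<lambda>x. \<integral>\<omega>. f (\<lambda>t\<in>I. \<sigma> t \<omega> / x) \<partial>uniform_measure M {\<omega> \<in> space M. \<bar>\<zeta> 0 \<omega>\<bar> > x})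
    \<longlongrightarrow> (\<integral>\<omega>. f (\<lambda>t\<in>I. S t \<omega>) \<partial>N)) at_top"
proof -
  let ?E = "\<lambda>x. {\<omega> \<in> space M. \<bar>\<zeta> 0 \<omega>\<bar> > x}"
  have lim: "((\<lambda>x. (\<integral>\<omega>. g (\<lambda>t\<in>I. \<sigma> t \<omega> / x) * indicator (?E x) \<omega> \<partial>M) / V.tail x)
      \<longlongrightarrow> tilt_const * (\<integral>\<omega>. g (\<lambda>t\<in>I. S t \<omega>) \<partial>N)) at_top"
    if g: "continuous_on UNIV g" "\<And>y. \<bar>g y\<bar> \<le> C" for g :: "(int \<Rightarrow> real) \<Rightarrow> real" and C
  proof -
    have I': "I \<subseteq> {r..}" using I by auto
    show ?thesis
      unfolding tilted_expectation[OF g r n I, symmetric]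
      by (rule tail_functional_tendsto[OF g r I' real_distribution_pareto_law pareto_law_tail])
  qed
  \<comment> \<open>The case of the constant 1. Its positive limit also shows that the conditioning
    event eventually has positive probability.\<close>
  have limE: "((\<lambda>x. prob (?E x) / V.tail x) \<longlongrightarrow> tilt_const) at_top"
    using lim[of "\<lambda>_. 1" 1] by (simp add: T.prob_space)
  have "((\<lambda>x. (\<integral>\<omega>. f (\<lambda>t\<in>I. \<sigma> t \<omega> / x) * indicator (?E x) \<omega> \<partial>M) / V.tail x / (prob (?E x) / V.tail x))
      \<longlongrightarrow> tilt_const * (\<integral>\<omega>. f (\<lambda>t\<in>I. S t \<omega>) \<partial>N) / tilt_const) at_top"
    by (rule tendsto_divide[OF lim[OF f B] limE]) (use tilt_const_pos in simp)
  then have "((\<lambda>x. (\<integral>\<omega>. f (\<lambda>t\<in>I. \<sigma> t \<omega> / x) * indicator (?E x) \<omega> \<partial>M) / V.tail x / (prob (?E x) / V.tail x))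
      \<longlongrightarrow> (\<integral>\<omega>. f (\<lambda>t\<in>I. S t \<omega>) \<partial>N)) at_top"
    using tilt_const_pos by simp
  then show ?thesis
  proof (rule Lim_transform_eventually)
    have "\<forall>\<^sub>F x in at_top. prob (?E x) / V.tail x > 0"
      using order_tendstoD(1)[OF limE tilt_const_pos] .
    then show "\<forall>\<^sub>F x in at_top.
        (\<integral>\<omega>. f (\<lambda>t\<in>I. \<sigma> t \<omega> / x) * indicator (?E x) \<omega> \<partial>M) / V.tail x / (prob (?E x) / V.tail x) =
        (\<integral>\<omega>. f (\<lambda>t\<in>I. \<sigma> t \<omega> / x) \<partial>uniform_measure M (?E x))"
    proof eventually_elim
      case (elim x)
      then have nz: "prob (?E x) \<noteq> 0" by auto
      have "(\<lambda>\<omega>. f (\<lambda>t\<in>I. \<sigma> t \<omega> / x)) \<in> borel_measurable M"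
        by (rule borel_measurable_continuous_restrict[OF f]) measurable
      then show ?case using V.tail_pos[of x] by (subst integral_uniform_measure[OF _ nz]) simp_all
    qed
  qed
qed

end

section \<open>Weak convergence on a finite window\<close>

theorem proposition6p2:
  fixes M :: "'a measure" and N :: "'b measure"
    and \<alpha>0 \<alpha>1 \<beta>1 \<alpha> :: real
    and \<epsilon> \<zeta> \<sigma> :: "int \<Rightarrow> 'a \<Rightarrow> real"
    and Z e :: "'b \<Rightarrow> real" and h A S :: "int \<Rightarrow> 'b \<Rightarrow> real"
    and m n :: nat
  assumes garch: "garch11 M \<alpha>0 \<alpha>1 \<beta>1 \<alpha> \<epsilon> \<zeta> \<sigma>"
    and reg_var: "\<And>u. u > 0 \<Longrightarrow>
          ((\<lambda>x. measure M {\<omega> \<in> space M. \<sigma> 0 \<omega> > u * x} / measure M {\<omega> \<in> space M. \<sigma> 0 \<omega> > x})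
             \<longlongrightarrow> u powr (- 2 * \<alpha>)) at_top"
    and tail_process: "garch11_tail_process N \<alpha>1 \<beta>1 \<alpha> Z e h A S"
  shows "weak_conv_on (product_topology (\<lambda>_. euclideanreal) {- int m..int n})
           (\<lambda>x. cond_law M (\<Pi>\<^sub>M t\<in>{- int m..int n}. borel)
                  (\<lambda>\<omega>. \<lambda>t\<in>{- int m..int n}. \<sigma> t \<omega> / x)
                  {\<omega> \<in> space M. \<bar>\<zeta> 0 \<omega>\<bar> > x})
           (distr N (\<Pi>\<^sub>M t\<in>{- int m..int n}. borel) (\<lambda>\<omega>. \<lambda>t\<in>{- int m..int n}. S t \<omega>))
           at_top"
proof -
  interpret garch11_limit M \<alpha>0 \<alpha>1 \<beta>1 \<alpha> \<epsilon> \<zeta> \<sigma> N Z e h A S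
    by (intro garch11_limit.intro garch11_regvar.intro garch11_regvar_axioms.intro garch reg_var tail_process)
  let ?I = "{- int m..int n}"
  let ?X = "product_topology (\<lambda>_. euclideanreal) ?I"
  let ?P = "\<Pi>\<^sub>M t\<in>?I. (borel :: real measure)"
  show ?thesis unfolding weak_conv_on_def
  proof (intro allI impI, elim conjE)
    fix f :: "(int \<Rightarrow> real) \<Rightarrow> real"
    assume f: "continuous_map ?X euclideanreal f" and bdd: "bounded (f ` topspace ?X)"
    \<comment> \<open>Composing with the restriction to the window extends f to all functions on the
      integers; continuity in the finite product topology becomes ordinary continuity on
      \<open>UNIV\<close>.\<close>
    define g where "g y = f (\<lambda>t\<in>?I. y t)" for y
    have "continuous_map (euclidean :: (int \<Rightarrow> real) topology) ?X (\<lambda>y. \<lambda>t\<in>?I. y t)"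
      by (auto simp: continuous_map_componentwise continuous_on_product_coordinates)
    from continuous_map_compose[OF this f] have g: "continuous_on UNIV g"
      by (simp add: g_def[abs_def] comp_def)
    obtain B where B: "\<And>y. y \<in> topspace ?X \<Longrightarrow> norm (f y) \<le> B"
      using bdd by (auto simp: bounded_iff)
    have gB: "\<bar>g y\<bar> \<le> B" for y
      unfolding g_def real_norm_def[symmetric] by (rule B) (simp add: topspace_product_topology)
    have f_meas: "f \<in> borel_measurable ?P"
    proof -
      have "(\<lambda>y. g (\<lambda>t\<in>?I. y t)) \<in> borel_measurable ?P"
        by (rule borel_measurable_continuous_restrict[OF g]) (rule measurable_component_singleton)
      then show ?thesis
        by (rule measurable_cong[THEN iffD1, rotated])
           (auto simp: g_def space_PiM restrict_restrict PiE_restrict)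
    qed
    have restr: "f (\<lambda>t\<in>?I. y t) = g (\<lambda>t\<in>?I. y t)" for y
      unfolding g_def by (simp only: restrict_restrict Int_absorb)
    have cond: "(\<integral>y. f y \<partial>cond_law M ?P (\<lambda>\<omega>. \<lambda>t\<in>?I. \<sigma> t \<omega> / x) E) =
        (\<integral>\<omega>. g (\<lambda>t\<in>?I. \<sigma> t \<omega> / x) \<partial>uniform_measure M E)" for x E
      unfolding cond_law_def by (subst integral_distr) (auto intro!: measurable_restrict f_meas simp: restr)
    have limit: "(\<integral>y. f y \<partial>distr N ?P (\<lambda>\<omega>. \<lambda>t\<in>?I. S t \<omega>)) = (\<integral>\<omega>. g (\<lambda>t\<in>?I. S t \<omega>) \<partial>N)"
      by (subst integral_distr) (auto intro!: measurable_restrict f_meas simp: restr)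
    show "((\<lambda>x. \<integral>y. f y \<partial>cond_law M ?P (\<lambda>\<omega>. \<lambda>t\<in>?I. \<sigma> t \<omega> / x) {\<omega> \<in> space M. \<bar>\<zeta> 0 \<omega>\<bar> > x})
        \<longlongrightarrow> (\<integral>y. f y \<partial>distr N ?P (\<lambda>\<omega>. \<lambda>t\<in>?I. S t \<omega>))) at_top"
      unfolding cond limit
      \<comment> \<open>The frame must contain coordinate 1, which carries \<open>S 1\<close>, even
        for n = 0; the window itself may be smaller than the frame.\<close>
      by (rule conditional_expectation_tendsto[OF g gB, of "- int m" "max 1 (int n)"]) auto
  qed
qed

end
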